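(* There exist absolute constants $C_1, C_2$ (independent of all problem parameters) such that the following holds. For every number of products $N\ge 1$, every feasible family $\mathcal{S}$ of assortments given by totally unimodular constraints and closed under taking subsets, all revenues $r_1,\dots,r_N\in[0,1]$, all MNL parameters $\mathbf{v}=(v_0,v_1,\dots,v_N)$ with $v_0=1$ and $v_i\le v_0=1$ for $i=1,\dots,N$, and every time $T\ge 1$, the regret of the policy $\pi$ given by Algorithm 1 (described in the context) satisfies $$Reg_\pi(T,\mathbf{v}) \le C_1\sqrt{NT\log (NT)} + C_2 N\log^2 (NT).$$
   Context: **MNL-Bandit problem.** There are $N$ products with known revenues $r_i$ and unknown attraction parameters $v_i>0$; $v_0=1$ is the parameter of the no-purchase option $0$. The feasible assortments are $\mathcal{S}=\{S\subseteq\{1,\dots,N\} : A\,\mathbf{x}(S)\le \mathbf{b}\}$, where $\mathbf{x}(S)\in\{0,1\}^N$ is the incidence vector of $S$, $A$ is a totally unimodular matrix and $\mathbf{b}$ is an integral vector; moreover $S\in\mathcal{S}$ and $Q\subseteq S$ imply $Q\in\mathcal{S}$. At each time $t$ the seller offers $S_t\in\mathcal{S}$ and observes $c_t\in S_t\cup\{0\}$, where, conditionally on $S_t=S$, $c_t$ is independent of the past and $\mathbb{P}(c_t=i\mid S_t=S)=v_i/(v_0+\sum_{j\in S}v_j)$ for $i\in S\cup\{0\}$. The expected revenue of $S$ is $R(S,\mathbf{v})=\sum_{i\in S} r_iv_i/(1+\sum_{j\in S}v_j)$. With $S^*\in\arg\max_{S\in\mathcal{S}}R(S,\mathbf{v})$,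 the regret of a policy $\pi$ is $Reg_\pi(T,\mathbf{v})=\sum_{t=1}^T \big(R(S^*,\mathbf{v})-\mathbb{E}_\pi[R(S_t,\mathbf{v})]\big)$, where $S_t$ is the assortment offered by $\pi$ at time $t$. **Algorithm 1.** Put $v^{\sf UCB}_{i,0}=1$ for all $i$. Time is divided into consecutive epochs $\ell=1,2,\dots$. In epoch $\ell$ the assortment $$S_\ell\in\arg\max_{S\in\mathcal{S}}\tilde R_\ell(S),\qquad \tilde R_\ell(S)=\frac{\sum_{i\in S}r_iv^{\sf UCB}_{i,\ell-1}}{1+\sum_{j\in S}v^{\sf UCB}_{j,\ell-1}}$$ (ties broken by an arbitrary rule) is offered at every time step until, and including, the first time step at which a no-purchase occurs; $\mathcal{E}_\ell$ is the set of time steps of epoch $\ell$. At the end of epoch $\ell$ let $\hat v_{i,\ell}=\sum_{t\in\mathcal{E}_\ell}\mathbf{1}(c_t=i)$, $\mathcal{T}_i(\ell)=\{\tau\le\ell : i\in S_\tau\}$, $T_i(\ell)=|\mathcal{T}_i(\ell)|$, $\bar v_{i,\ell}=\frac1{T_i(\ell)}\sum_{\tau\in\mathcal{T}_i(\ell)}\hat v_{i,\tau}$, and $$v^{\sf UCB}_{i,\ell}=\bar v_{i,\ell}+\sqrt{\bar v_{i,\ell}\,\frac{48\log(\sqrt N\ell+1)}{T_i(\ell)}}+\frac{48\log(\sqrt N\ell+1)}{T_i(\ell)}$$ for every $i$ with $T_i(\ell)\ge1$; for products with $T_i(\ell)=0$ the value stays $v^{\sf UCB}_{i,\ell}=1$.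 The policy is run for the time steps $1,\dots,T$ (the last epoch may be truncated). *)

theory Defs
  imports
    "HOL-Probability.Probability"
    "Jordan_Normal_Form.Determinant"
    "Jordan_Normal_Form.DL_Submatrix"
begin

section \<open>Feasible assortments\<close>

definition totally_unimodular :: "real mat \<Rightarrow> bool" where
  "totally_unimodular A \<longleftrightarrow>
     (\<forall>I J. I \<subseteq> {..<dim_row A} \<longrightarrow> J \<subseteq> {..<dim_col A} \<longrightarrow> card I = card J \<longrightarrow>
        Determinant.det (submatrix A I J) \<in> {-1, 0, 1})"

definition integral_vec :: "real Matrix.vec \<Rightarrow> bool" where
  "integral_vec b \<longleftrightarrow> (\<forall>k<dim_vec b. vec_index b k \<in> \<int>)"

text \<open>Products are numbered from \<open>1\<close> to \<open>N\<close>, and \<open>0\<close> is the no-purchase option. Vector and matrix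
  indices start at \<open>0\<close>, so product \<open>i\<close> belongs to coordinate \<open>i - 1\<close>.\<close>

definition incidence_vec :: "nat \<Rightarrow> nat set \<Rightarrow> real Matrix.vec" where
  "incidence_vec N S = Matrix.vec N (\<lambda>j. if Suc j \<in> S then 1 else 0)"

definition feasible :: "nat \<Rightarrow> real mat \<Rightarrow> real Matrix.vec \<Rightarrow> nat set set" where
  "feasible N A b = {S. S \<subseteq> {1..N} \<and> A *\<^sub>v incidence_vec N S \<le> b}"


section \<open>The multinomial logit choice model\<close>

definition revenue :: "(nat \<Rightarrow> real) \<Rightarrow> (nat \<Rightarrow> real) \<Rightarrow> nat set \<Rightarrow> real" where
  "revenue r v S = (\<Sum>i\<in>S. r i * v i) / (1 + (\<Sum>j\<in>S. v j))"

definition mnl_choice :: "(nat \<Rightarrow> real) \<Rightarrow> nat set \<Rightarrow> nat pmf" where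
  "mnl_choice v S =
     embed_pmf (\<lambda>i. if i \<in> S \<union> {0} then v i / (v 0 + (\<Sum>j\<in>S. v j)) else 0)"

lemma pmf_mnl_choice:
  assumes "S \<subseteq> {1..N}" "\<And>i. i \<in> {0..N} \<Longrightarrow> v i > 0"
  shows "pmf (mnl_choice v S) i =
    (if i \<in> S \<union> {0} then v i / (v 0 + (\<Sum>j\<in>S. v j)) else 0)"
proof -
  have fin: "finite S" using assms(1) finite_subset by blast
  have "0 \<notin> S" using assms(1) by auto
  have pos: "v j > 0" if "j \<in> S \<union> {0}" for j using that assms by auto
  have sp: "v 0 + (\<Sum>j\<in>S. v j) > 0"
    using pos by (intro add_pos_nonneg sum_nonneg) (auto intro: less_imp_le)
  let ?f = "\<lambda>i. if i \<in> S \<union> {0} then v i / (v 0 + (\<Sum>j\<in>S. v j)) else 0"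
  have nn: "0 \<le> ?f i" for i using pos[of i] sp by auto
  have "(\<integral>\<^sup>+i. ennreal (?f i) \<partial>count_space UNIV)
      = (\<integral>\<^sup>+i. ennreal (?f i) \<partial>count_space (S \<union> {0}))"
    by (intro nn_integral_count_space_eq) auto
  also have "\<dots> = (\<Sum>i\<in>S \<union> {0}. ennreal (?f i))"
    using fin by (intro nn_integral_count_space_finite) auto
  also have "\<dots> = ennreal (\<Sum>i\<in>S \<union> {0}. ?f i)"
    by (rule sum_ennreal, rule nn)
  also have "(\<Sum>i\<in>S \<union> {0}. ?f i) = (\<Sum>i\<in>S \<union> {0}. v i / (v 0 + (\<Sum>j\<in>S. v j)))"
    by (intro sum.cong) auto
  also have "\<dots> = 1"
    using fin \<open>0 \<notin> S\<close> sp by (simp add: sum_divide_distrib[symmetric] add_divide_distrib[symmetric])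
  finally show ?thesis
    unfolding mnl_choice_def using nn by (subst pmf_embed_pmf) auto
qed


section \<open>Policies and regret\<close>

text \<open>A history \<open>[(S\<^sub>1, c\<^sub>1), \<dots>, (S\<^sub>t, c\<^sub>t)]\<close> lists the offered assortments and the observed
  choices in chronological order. A policy maps a history to the distribution of the next
  assortment; deterministic rules are the point masses.\<close>

type_synonym history = "(nat set \<times> nat) list"
type_synonym policy = "history \<Rightarrow> nat set pmf"

definition offer :: "history \<Rightarrow> nat \<Rightarrow> nat set" where
  "offer h t = fst (h ! (t - 1))"

definition choice :: "history \<Rightarrow> nat \<Rightarrow> nat" where
  "choice h t = snd (h ! (t - 1))"

primrec history_pmf :: "(nat \<Rightarrow> real) \<Rightarrow> policy \<Rightarrow> nat \<Rightarrow> history pmf" where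
  "history_pmf v \<pi> 0 = return_pmf []"
| "history_pmf v \<pi> (Suc t) =
     bind_pmf (history_pmf v \<pi> t) (\<lambda>h.
       bind_pmf (\<pi> h) (\<lambda>S.
         map_pmf (\<lambda>c. h @ [(S, c)]) (mnl_choice v S)))"

text \<open>The argument \<open>Sstar\<close> is meant to be an optimal feasible assortment.\<close>

definition regret ::
    "(nat \<Rightarrow> real) \<Rightarrow> (nat \<Rightarrow> real) \<Rightarrow> nat set \<Rightarrow> policy \<Rightarrow> nat \<Rightarrow> real" where
  "regret r v Sstar \<pi> T =
     (\<Sum>t = 1..T. revenue r v Sstar -
        measure_pmf.expectation (history_pmf v \<pi> T) (\<lambda>h. revenue r v (offer h t)))"


section \<open>The upper confidence bound algorithm\<close>

text \<open>All quantities are computed from the observed history \<open>h\<close>. Those indexed by an epoch \<open>l\<close> are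
  only used for completed epochs, so that truncation of the last epoch does not affect them.\<close>

definition completed_epochs :: "history \<Rightarrow> nat" where
  "completed_epochs h = card {t \<in> {1..length h}. choice h t = 0}"

definition epoch_of :: "history \<Rightarrow> nat \<Rightarrow> nat" where
  "epoch_of h t = 1 + card {s \<in> {1..<t}. choice h s = 0}"

definition epoch_steps :: "history \<Rightarrow> nat \<Rightarrow> nat set" where
  "epoch_steps h l = {t \<in> {1..length h}. epoch_of h t = l}"

definition epoch_offer :: "history \<Rightarrow> nat \<Rightarrow> nat set" where
  "epoch_offer h l = offer h (Min (epoch_steps h l))"

definition v_hat :: "history \<Rightarrow> nat \<Rightarrow> nat \<Rightarrow> real" where
  "v_hat h i l = (\<Sum>t\<in>epoch_steps h l. of_bool (choice h t = i))"

definition offering_epochs :: "history \<Rightarrow> nat \<Rightarrow> nat \<Rightarrow> nat set" where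
  "offering_epochs h i l = {\<tau> \<in> {1..l}. i \<in> epoch_offer h \<tau>}"

definition num_offers :: "history \<Rightarrow> nat \<Rightarrow> nat \<Rightarrow> nat" where
  "num_offers h i l = card (offering_epochs h i l)"

definition v_bar :: "history \<Rightarrow> nat \<Rightarrow> nat \<Rightarrow> real" where
  "v_bar h i l = (1 / real (num_offers h i l)) * (\<Sum>\<tau>\<in>offering_epochs h i l. v_hat h i \<tau>)"

definition v_ucb :: "nat \<Rightarrow> history \<Rightarrow> nat \<Rightarrow> nat \<Rightarrow> real" where
  "v_ucb N h i l =
     (if num_offers h i l = 0 then 1
      else v_bar h i l
         + sqrt (v_bar h i l *
             (48 * ln (sqrt (real N) * real l + 1) / real (num_offers h i l)))
         + 48 * ln (sqrt (real N) * real l + 1) / real (num_offers h i l))"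

text \<open>The assortments which the algorithm may offer after history \<open>h\<close>: a maximiser of the optimistic
  revenue when a new epoch starts, and the previous assortment otherwise.\<close>

definition algorithm_may_offer ::
    "nat \<Rightarrow> nat set set \<Rightarrow> (nat \<Rightarrow> real) \<Rightarrow> history \<Rightarrow> nat set \<Rightarrow> bool" where
  "algorithm_may_offer N F r h S \<longleftrightarrow>
     (if h = [] \<or> choice h (length h) = 0
      then is_arg_max (revenue r (\<lambda>i. v_ucb N h i (completed_epochs h))) (\<lambda>S. S \<in> F) S
      else S = offer h (length h))"

text \<open>The tie-breaking rule is arbitrary; it may be randomised and depend on the whole history.\<close>

definition algorithm_policy ::
    "nat \<Rightarrow> nat set set \<Rightarrow> (nat \<Rightarrow> real) \<Rightarrow> policy \<Rightarrow> bool" where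
  "algorithm_policy N F r \<pi> \<longleftrightarrow> (\<forall>h. \<forall>S\<in>set_pmf (\<pi> h). algorithm_may_offer N F r h S)"

end

theory Submission
  imports Defs
begin

text \<open>Write \<open>V S\<close> for the sum of the \<open>v i\<close> over \<open>S\<close>. A no-purchase has probability
  \<open>1 / (1 + V S)\<close> when \<open>S\<close> is offered, so the expected regret does not change if the gap of \<open>S\<close> is
  charged, with weight \<open>1 + V S\<close>, only at the no-purchase times, even when the last epoch is
  truncated. These times are the ends of the completed epochs. If all upper confidence bounds of an
  epoch are valid, the weighted gap is at most the sum over \<open>i \<in> S\<close> of their errors, because every
  product of an optimal assortment has revenue at least the optimal value. The errors are of order
  \<open>sqrt (v i * L / n) + L / n\<close> with \<open>n\<close> the number of earlier epochs that offered \<open>i\<close>; they are summed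
  over \<open>n\<close>, and the expected sum of \<open>v i\<close> times the final \<open>n\<close> is at most \<open>T\<close>. The probability that
  a bound fails is estimated by the exponential supermartingales \<open>exp (a * m - b * n)\<close>, where \<open>m\<close>
  counts the purchases of \<open>i\<close> and \<open>n\<close> the no-purchases while \<open>i\<close> is offered, both stopped after
  \<open>k\<close> epochs.\<close>

subsection \<open>Deviations of geometric sums\<close>

lemma ln_one_plus_ge_quadratic:
  fixes y :: real
  assumes "0 \<le> y"
  shows "y - y\<^sup>2 / 2 \<le> ln (1 + y)"
proof -
  let ?f = "\<lambda>y::real. ln (1 + y) - y + y\<^sup>2 / 2"
  have "?f 0 \<le> ?f y"
  proof (rule DERIV_nonneg_imp_nondecreasing[OF assms])
    fix x :: real assume x: "0 \<le> x" "x \<le> y"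
    have "DERIV ?f x :> 1 / (1 + x) - 1 + x"
      using x by (auto intro!: derivative_eq_intros)
    moreover have "1 / (1 + x) - 1 + x = x\<^sup>2 / (1 + x)"
      using x by (simp add: field_simps power2_eq_square)
    moreover have "0 \<le> x\<^sup>2 / (1 + x)" using x by simp
    ultimately show "\<exists>d. DERIV ?f x :> d \<and> 0 \<le> d" by auto
  qed
  then show ?thesis by simp
qed

text \<open>The right-hand side times the Taylor bound
  \<open>1 + s + s\<^sup>2 / 2 \<le> exp s\<close> equals \<open>1 + s^4 / 4\<close>, which is at
  least 1.\<close>

lemma exp_minus_le_quadratic:
  fixes s :: real
  assumes "0 \<le> s"
  shows "exp (- s) \<le> 1 - s + s\<^sup>2 / 2"
proof -
  have 1: "1 + s + s\<^sup>2 / 2 \<le> exp s" using exp_lower_Taylor_quadratic[OF assms] .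
  have "1 - s + s\<^sup>2 / 2 = ((1 - s)\<^sup>2 + 1) / 2" by (simp add: field_simps power2_eq_square)
  then have 2: "0 \<le> 1 - s + s\<^sup>2 / 2"
    by (metis add_nonneg_nonneg divide_nonneg_nonneg zero_le_numeral zero_le_one zero_le_power2)
  have "1 \<le> (1 + s + s\<^sup>2 / 2) * (1 - s + s\<^sup>2 / 2)"
  proof -
    have "(1 + s + s\<^sup>2 / 2) * (1 - s + s\<^sup>2 / 2) = 1 + (s\<^sup>2)\<^sup>2 / 4"
      by (simp add: field_simps power2_eq_square)
    then show ?thesis by simp
  qed
  also have "\<dots> \<le> exp s * (1 - s + s\<^sup>2 / 2)" by (intro mult_right_mono 1 2)
  finally show ?thesis by (simp add: exp_minus field_simps)
qed

text \<open>If \<open>X\<close> is geometric with mean \<open>v\<close>, then \<open>exp (a * X)\<close> has mean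
  \<open>1 / (1 - v * (exp a - 1))\<close>, so the condition below says that this mean is at most \<open>exp b\<close>.\<close>

definition exponent_pair :: "real \<Rightarrow> real \<Rightarrow> real \<Rightarrow> bool" where
  "exponent_pair v a b \<longleftrightarrow> v * (exp a - 1) \<le> 1 - exp (- b)"

text \<open>A Chernoff bound. The tight \<open>b\<close> is at most
  \<open>v * a + 5 * v * a\<^sup>2\<close>, so it suffices that the deviation dominates
  \<open>5 * a * (v * n) + x / a\<close>. The free minimiser
  \<open>a = sqrt (x / (5 * v * n))\<close> gives \<open>sqrt (20 * v * n * x)\<close>; the cap
  \<open>1/3\<close> keeps the quadratic estimates valid and costs the term
  \<open>6 * x\<close>.\<close>

lemma exponent_pair_upper:
  fixes v n x :: real
  assumes v: "0 < v" "v \<le> 1" and n: "0 < n" and x: "0 < x"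
  shows "\<exists>a b. exponent_pair v a b \<and>
    (\<forall>m. v * n + sqrt (20 * v * n * x) + 6 * x \<le> m \<longrightarrow> x \<le> a * m - b * n)"
proof -
  define a where "a = min (1/3) (sqrt (x / (5 * v * n)))"
  define y where "y = v * (exp a - 1)"
  define b where "b = - ln (1 - y)"
  have a: "0 < a" "a \<le> 1/3" using v n x by (auto simp: a_def)
  have e: "exp a - 1 \<le> a + a\<^sup>2" using exp_bound[of a] a by simp
  have a2: "a\<^sup>2 \<le> a / 3" using a by (simp add: power2_eq_square)
  have y0: "0 \<le> y" using v a by (simp add: y_def)
  have y1: "y \<le> v * (a + a\<^sup>2)" unfolding y_def using e v by (intro mult_left_mono) auto
  also have "\<dots> \<le> 1 * (a + a\<^sup>2)" using v a by (intro mult_right_mono) auto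
  \<comment> \<open>Here \<open>a + a\<^sup>2 \<le> 4/9\<close>, so the lower bound for
    \<open>ln (1 - y)\<close> on \<open>y \<le> 1/2\<close> becomes available.\<close>
  finally have y2: "y \<le> 1/2" and y3: "y \<le> 4/3 * a" using a a2 by auto
  have pair: "exponent_pair v a b" using y2 by (simp add: exponent_pair_def b_def y_def)
  have "- y - 2 * y\<^sup>2 \<le> ln (1 - y)" using ln_one_minus_pos_lower_bound[OF y0 y2] .
  then have "b \<le> y + 2 * y\<^sup>2" by (simp add: b_def)
  moreover have "y\<^sup>2 \<le> 16 / 9 * (v * a\<^sup>2)"
  proof -
    have "y * y \<le> (v * (4/3 * a)) * (4/3 * a)"
    proof (rule mult_mono)
      have "v * (a + a\<^sup>2) \<le> v * (4/3 * a)" using a2 v by (intro mult_left_mono) auto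
      then show "y \<le> v * (4/3 * a)" using y1 by simp
    qed (use y0 y3 v a in auto)
    then show ?thesis by (simp add: power2_eq_square)
  qed
  moreover have "v * (a + a\<^sup>2) = v * a + v * a\<^sup>2" "0 \<le> v * a\<^sup>2"
    using v by (auto simp: algebra_simps)
  \<comment> \<open>The coefficient \<open>1 + 2 * 16/9 = 41/9\<close> is rounded up to 5.\<close>
  ultimately have b: "b \<le> v * a + 5 * v * a\<^sup>2" using y1 by (simp add: algebra_simps)
  have bound: "5 * a * (v * n) + x / a \<le> sqrt (20 * v * n * x) + 6 * x"
  proof (cases "sqrt (x / (5 * v * n)) \<le> 1/3")
    case True
    define p where "p = sqrt (5 * v * n)"
    define q where "q = sqrt x"
    have pq: "0 < p" "0 < q" "p\<^sup>2 = 5 * v * n" "q\<^sup>2 = x" using v n x by (auto simp: p_def q_def)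
    have "a = q / p" using True by (simp add: a_def p_def q_def real_sqrt_divide)
    moreover have "sqrt (20 * v * n * x) = 2 * p * q"
    proof (rule real_sqrt_unique)
      show "(2 * p * q)\<^sup>2 = 20 * v * n * x" using pq by (simp add: power_mult_distrib)
    qed (use pq in auto)
    moreover have "5 * (q / p) * (v * n) = p * q"
    proof -
      have "5 * (q / p) * (v * n) = q / p * p\<^sup>2" using pq by simp
      then show ?thesis using pq(1) by (simp add: power2_eq_square)
    qed
    moreover have "x / (q / p) = p * q" using pq by (simp add: power2_eq_square flip: pq(4))
    ultimately show ?thesis using x by simp
  next
    case False
    have "a = 1/3" using False by (simp add: a_def)
    have "(1/3)\<^sup>2 < x / (5 * v * n)"
    proof (rule ccontr)
      assume "\<not> (1/3)\<^sup>2 < x / (5 * v * n)"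
      then have "sqrt (x / (5 * v * n)) \<le> 1/3" using v n x by (intro real_le_lsqrt) auto
      then show False using False by simp
    qed
    then have "5 * (1/3) * (v * n) < 3 * x" using v n by (simp add: field_simps power2_eq_square)
    then have "5 * (1/3) * (v * n) + x / (1/3) \<le> 0 + 6 * x" by simp
    also have "\<dots> \<le> sqrt (20 * v * n * x) + 6 * x" using v n x by (intro add_right_mono) simp
    finally show ?thesis unfolding \<open>a = 1/3\<close> .
  qed
  have "x \<le> a * m - b * n" if m: "v * n + sqrt (20 * v * n * x) + 6 * x \<le> m" for m
  proof -
    have "v * n + (5 * a * (v * n) + x / a) \<le> m" using m bound by linarith
    then have "a * (v * n + (5 * a * (v * n) + x / a)) \<le> a * m" using a by (intro mult_left_mono) auto
    moreover have "a * (v * n + (5 * a * (v * n) + x / a)) = (v * a + 5 * v * a\<^sup>2) * n + x"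
      using a by (simp add: field_simps power2_eq_square)
    moreover have "b * n \<le> (v * a + 5 * v * a\<^sup>2) * n" using b n by (intro mult_right_mono) auto
    ultimately show ?thesis by linarith
  qed
  then show ?thesis using pair by blast
qed

text \<open>With \<open>a = - s\<close> both quadratic estimates hold for all
  \<open>s \<ge> 0\<close>, so there is neither a cap nor a linear term. They give
  \<open>- b \<ge> v * s - v * s\<^sup>2\<close>; for \<open>s = sqrt (x / (v * n))\<close> the
  deviation contributes \<open>2 * x\<close>, of which \<open>x\<close> pays for the quadratic
  part.\<close>

lemma exponent_pair_lower:
  fixes v n x :: real
  assumes v: "0 < v" "v \<le> 1" and n: "0 < n" and x: "0 < x"
  shows "\<exists>a b. exponent_pair v a b \<and>
    (\<forall>m. m \<le> v * n - 2 * sqrt (v * n * x) \<longrightarrow> x \<le> a * m - b * n)"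
proof -
  define p where "p = sqrt (v * n)"
  define q where "q = sqrt x"
  have pq: "0 < p" "0 < q" "p\<^sup>2 = v * n" "q\<^sup>2 = x" using v n x by (auto simp: p_def q_def)
  define s where "s = q / p"
  have s: "0 < s" using pq by (simp add: s_def)
  define y where "y = v * (1 - exp (- s))"
  define b where "b = - ln (1 + y)"
  have y0: "0 \<le> y" using v s by (simp add: y_def)
  have "y \<le> v * s" unfolding y_def using exp_ge_add_one_self[of "-s"] v by (intro mult_left_mono) auto
  then have "y * y \<le> (v * s) * (1 * s)"
    using y0 v s by (intro mult_mono) (auto intro: order_trans[of _ "v * s"] mult_right_mono)
  then have y2: "y\<^sup>2 \<le> v * s\<^sup>2" by (simp add: power2_eq_square)
  have "v * (s - s\<^sup>2 / 2) \<le> y"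
    unfolding y_def using exp_minus_le_quadratic[of s] s v by (intro mult_left_mono) auto
  then have "v * s - v * s\<^sup>2 \<le> y - y\<^sup>2 / 2" using y2 by (simp add: algebra_simps)
  then have l: "v * s - v * s\<^sup>2 \<le> ln (1 + y)" using ln_one_plus_ge_quadratic[OF y0] by linarith
  have pair: "exponent_pair v (- s) b" using y0 by (simp add: exponent_pair_def b_def y_def algebra_simps)
  have "x \<le> (- s) * m - b * n" if m: "m \<le> v * n - 2 * sqrt (v * n * x)" for m
  proof -
    have "(v * s - v * s\<^sup>2) * n \<le> ln (1 + y) * n" using l n by (intro mult_right_mono) auto
    moreover have "s * m \<le> s * (v * n - 2 * sqrt (v * n * x))" using m s by (intro mult_left_mono) auto
    moreover have "sqrt (v * n * x) = p * q" by (simp add: p_def q_def real_sqrt_mult)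
    moreover have "s * (p * q) = x" using pq by (simp add: s_def power2_eq_square flip: pq(4))
    moreover have "v * s\<^sup>2 * n = x"
    proof -
      have "v * s\<^sup>2 * n = (p * s)\<^sup>2" using pq by (simp add: power_mult_distrib)
      moreover have "p * s = q" using pq(1) by (simp add: s_def)
      ultimately show ?thesis using pq by simp
    qed
    ultimately show ?thesis by (simp add: b_def algebra_simps)
  qed
  then show ?thesis using pair by blast
qed

text \<open>Completing squares in the square roots \<open>V\<close>, \<open>U\<close>,
  \<open>P\<close> of \<open>v\<close>, \<open>w\<close>, \<open>3 * q\<close> gives
  \<open>V \<le> U + 2 * P\<close>. Squaring yields the cross term \<open>4 * U * P\<close>, which
  is exactly \<open>sqrt (w * (48 * q))\<close>, and \<open>4 * P\<^sup>2 = 12 * q\<close>.\<close>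

lemma le_ucb_of_lower_deviation:
  fixes v w q :: real
  assumes "0 \<le> v" "0 \<le> w" "0 \<le> q" and le: "v - 2 * sqrt (3 * v * q) \<le> w"
  shows "v \<le> w + sqrt (w * (48 * q)) + 48 * q"
proof -
  define V where "V = sqrt v"
  define P where "P = sqrt (3 * q)"
  define U where "U = sqrt w"
  have nn: "0 \<le> V" "0 \<le> P" "0 \<le> U" and sq: "V\<^sup>2 = v" "P\<^sup>2 = 3 * q" "U\<^sup>2 = w"
    using assms by (auto simp: V_def P_def U_def)
  have "sqrt (3 * v * q) = V * P" by (simp add: V_def P_def real_sqrt_mult)
  then have "V\<^sup>2 - 2 * (V * P) \<le> U\<^sup>2" using le sq by simp
  moreover have "0 \<le> U * P" using nn by simp
  ultimately have "(V - P)\<^sup>2 \<le> (U + P)\<^sup>2" by (simp add: power2_eq_square algebra_simps)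
  then have "V - P \<le> U + P" using nn by (simp add: abs_le_square_iff[symmetric])
  then have "V\<^sup>2 \<le> (U + 2 * P)\<^sup>2" using nn by (intro power_mono) auto
  also have "\<dots> = w + 4 * (U * P) + 12 * q" using sq by (simp add: power2_sum power_mult_distrib)
  also have "4 * (U * P) = sqrt (w * (48 * q))"
    by (rule real_sqrt_unique[symmetric]) (use nn sq in \<open>auto simp: power_mult_distrib\<close>)
  finally show ?thesis using sq assms by simp
qed

text \<open>In square roots, \<open>w \<le> V\<^sup>2 + 8 * V * Q + 18 * Q\<^sup>2 \<le> (V + 5 *
  Q)\<^sup>2\<close>, so the middle term is at most \<open>7 * V * Q + 35 * Q\<^sup>2\<close>. The
  constants are 8 + 7 = 15 and 18 + 35 + 48 = 101.\<close>

lemma ucb_le_of_upper_deviation: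
  fixes v w q :: real
  assumes "0 \<le> v" "0 \<le> w" "0 \<le> q" and le: "w \<le> v + sqrt (60 * v * q) + 18 * q"
  shows "w + sqrt (w * (48 * q)) + 48 * q \<le> v + 15 * sqrt (v * q) + 101 * q"
proof -
  define V where "V = sqrt v"
  define Q where "Q = sqrt q"
  define U where "U = sqrt w"
  have nn: "0 \<le> V" "0 \<le> Q" "0 \<le> U" and sq: "V\<^sup>2 = v" "Q\<^sup>2 = q" "U\<^sup>2 = w"
    using assms by (auto simp: V_def Q_def U_def)
  have VQ: "sqrt (v * q) = V * Q" "0 \<le> V * Q" using nn by (auto simp: V_def Q_def real_sqrt_mult)
  have "sqrt (60 * v * q) \<le> 8 * (V * Q)"
    by (rule real_le_lsqrt) (use nn sq assms in \<open>auto simp: power_mult_distrib\<close>)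
  then have w: "w \<le> V\<^sup>2 + 8 * (V * Q) + 18 * Q\<^sup>2" using le sq by simp
  also have "\<dots> \<le> (V + 5 * Q)\<^sup>2" using VQ by (simp add: power2_eq_square algebra_simps)
  finally have U: "U \<le> V + 5 * Q" unfolding U_def using nn by (intro real_le_lsqrt) (use assms in auto)
  have "sqrt (w * (48 * q)) \<le> 7 * (U * Q)"
    by (rule real_le_lsqrt) (use nn sq assms in \<open>auto simp: power_mult_distrib\<close>)
  also have "\<dots> \<le> 7 * ((V + 5 * Q) * Q)" using U nn by (intro mult_left_mono mult_right_mono) auto
  also have "\<dots> = 7 * (V * Q) + 35 * Q\<^sup>2" by (simp add: power2_eq_square algebra_simps)
  finally show ?thesis using w sq VQ by simp
qed

text \<open>The constant \<open>48\<close> of the algorithm is just enough for the failure level \<open>exp (- 3 * L)\<close>: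
  the lower deviation produces the term \<open>4 * sqrt (3 * w * L / n)\<close>.\<close>

lemma ucb_concentration:
  fixes v L n :: real
  assumes v: "0 < v" "v \<le> 1" and n: "0 < n" and L: "0 < L"
  shows "\<exists>a b a' b'. exponent_pair v a b \<and> exponent_pair v a' b' \<and>
    (\<forall>m\<ge>0. let w = m / n; u = w + sqrt (w * (48 * L / n)) + 48 * L / n
       in (v \<le> u \<and> u \<le> v + 15 * sqrt (v * L / n) + 101 * L / n) \<or>
          1 \<le> exp (a * m - b * n - 3 * L) + exp (a' * m - b' * n - 3 * L))"
proof -
  have x: "0 < 3 * L" using L by simp
  \<comment> \<open>The exponents are fixed before \<open>m\<close>: later \<open>m\<close> is
    random, while \<open>n\<close> is a fixed candidate for the number of offers.\<close>
  obtain a b where ab: "exponent_pair v a b"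
    "\<And>m. v * n + sqrt (20 * v * n * (3 * L)) + 6 * (3 * L) \<le> m \<Longrightarrow> 3 * L \<le> a * m - b * n"
    using exponent_pair_upper[OF v n x] by blast
  obtain a' b' where ab': "exponent_pair v a' b'"
    "\<And>m. m \<le> v * n - 2 * sqrt (v * n * (3 * L)) \<Longrightarrow> 3 * L \<le> a' * m - b' * n"
    using exponent_pair_lower[OF v n x] by blast
  have main: "let w = m / n; u = w + sqrt (w * (48 * L / n)) + 48 * L / n
       in (v \<le> u \<and> u \<le> v + 15 * sqrt (v * L / n) + 101 * L / n) \<or>
          1 \<le> exp (a * m - b * n - 3 * L) + exp (a' * m - b' * n - 3 * L)" if m: "0 \<le> m" for m
  proof -
    define q where "q = L / n"
    define w where "w = m / n"
    have q: "0 \<le> q" "L = q * n" using L n by (auto simp: q_def)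
    have w: "0 \<le> w" "m = w * n" using m n by (auto simp: w_def)
    \<comment> \<open>Rescales deviations of the sum \<open>m\<close> to deviations of the mean
      \<open>w\<close>. The level \<open>3 * L\<close> turns the constants 20 and 6 into 60 and
      18.\<close>
    have sqrt_n: "sqrt (c * v * n * (3 * L)) = n * sqrt (3 * c * v * q)" for c
    proof -
      have "c * v * n * (3 * L) = n\<^sup>2 * (3 * c * v * q)"
        unfolding q(2) by (simp add: power2_eq_square)
      moreover have "sqrt (n\<^sup>2 * (3 * c * v * q)) = n * sqrt (3 * c * v * q)"
        using n by (simp only: real_sqrt_mult[of "n\<^sup>2"] real_sqrt_abs)
      ultimately show ?thesis by (simp only:)
    qed
    show ?thesis
    proof (cases "v * n + sqrt (20 * v * n * (3 * L)) + 6 * (3 * L) \<le> m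
        \<or> m \<le> v * n - 2 * sqrt (v * n * (3 * L))")
      case True
      then have "1 \<le> exp (a * m - b * n - 3 * L) \<or> 1 \<le> exp (a' * m - b' * n - 3 * L)"
        using ab(2)[of m] ab'(2)[of m] by auto
      then have "1 \<le> exp (a * m - b * n - 3 * L) + exp (a' * m - b' * n - 3 * L)"
        by (smt (verit) exp_ge_zero)
      then show ?thesis by (simp add: Let_def)
    next
      case False
      have "w * n \<le> (v + sqrt (60 * v * q) + 18 * q) * n"
        using False sqrt_n[of 20] q w by (simp add: algebra_simps)
      then have "w \<le> v + sqrt (60 * v * q) + 18 * q" using n by simp
      note up = ucb_le_of_upper_deviation[OF _ w(1) q(1) this]
      have "(v - 2 * sqrt (3 * v * q)) * n \<le> w * n"
        using False sqrt_n[of 1] q w by (simp add: algebra_simps)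
      then have "v - 2 * sqrt (3 * v * q) \<le> w" using n by simp
      note lo = le_ucb_of_lower_deviation[OF _ w(1) q(1) this]
      show ?thesis using up lo v by (simp add: Let_def q_def w_def)
    qed
  qed
  show ?thesis using ab(1) ab'(1) main by blast
qed

section \<open>Elementary sums and a weighted mean inequality\<close>

lemma sum_inverse_sqrt_le: "(\<Sum>j=1..n. 1 / sqrt (real j)) \<le> 2 * sqrt (real n)"
proof (induction n)
  case (Suc n)
  have "1 / sqrt (real (Suc n)) \<le> 2 * (sqrt (real (Suc n)) - sqrt (real n))"
  proof -
    define p q where "p = sqrt (real (Suc n))" and "q = sqrt (real n)"
    have "0 < p" "0 \<le> q" "q \<le> p" "p\<^sup>2 - q\<^sup>2 = 1" by (auto simp: p_def q_def)
    then have "(p - q) * (p + q) = 1" by (simp add: power2_eq_square algebra_simps)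
    moreover have "(p - q) * (p + q) \<le> (p - q) * (2 * p)"
      using \<open>q \<le> p\<close> by (intro mult_left_mono) auto
    ultimately have "1 \<le> 2 * (p - q) * p" by (simp only: mult_ac)
    then have "1 / p \<le> 2 * (p - q)" using \<open>0 < p\<close> by (simp only: pos_divide_le_eq)
    then show ?thesis by (simp only: p_def q_def)
  qed
  then show ?case using Suc by (simp del: of_nat_Suc)
qed simp

lemma sum_inverse_le: "(\<Sum>j=1..n. 1 / real j) \<le> 1 + ln (real n)" if "1 \<le> n"
  using that
proof (induction n rule: dec_induct)
  case (step n)
  have "ln (real n / real (Suc n)) \<le> real n / real (Suc n) - 1"
    using step by (intro ln_le_minus_one) auto
  moreover have "ln (real n / real (Suc n)) = ln (real n) - ln (real (Suc n))"
    using step by (subst ln_div) auto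
  moreover have "real n / real (Suc n) - 1 = - 1 / real (Suc n)" by (simp add: field_simps)
  ultimately show ?case using step by (simp del: of_nat_Suc)
qed simp

lemma sum_inverse_square_le: "(\<Sum>k=1..n. 1 / (real k)\<^sup>2) \<le> 2"
proof -
  have "(\<Sum>k=1..n. 1 / (real k)\<^sup>2) \<le> 2 - 1 / real n" if "1 \<le> n"
    using that
  proof (induction n rule: dec_induct)
    case (step n)
    have "1 / (real (Suc n))\<^sup>2 \<le> 1 / (real n * real (Suc n))"
      using step by (intro divide_left_mono) (auto simp: power2_eq_square)
    also have "\<dots> = 1 / real n - 1 / real (Suc n)"
      using step by (simp add: field_simps)
    finally have "1 / (real (Suc n))\<^sup>2 \<le> 1 / real n - 1 / real (Suc n)" .
    then show ?case using step by (simp del: of_nat_Suc)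
  qed simp
  moreover have "0 \<le> 1 / real n" by simp
  ultimately show ?thesis by (cases "1 \<le> n") (linarith, simp)
qed

text \<open>Listed in increasing order, the members of \<open>Z\<close> have 0, 1, 2, ... smaller
  members. For the closing times of the epochs that offer a product, this rank is the number of
  earlier offers, on which the error bound depends.\<close>

lemma sum_over_rank:
  fixes w :: "nat \<Rightarrow> real" and Z :: "nat set"
  assumes "finite Z"
  shows "(\<Sum>t\<in>Z. w (card {s \<in> Z. s < t})) = (\<Sum>j<card Z. w j)"
  using assms
proof (induction Z rule: finite_linorder_max_induct)
  case (insert b Z)
  have b: "b \<notin> Z" using insert by auto
  have "{s \<in> insert b Z. s < b} = Z" using insert by auto
  moreover have "{s \<in> insert b Z. s < t} = {s \<in> Z. s < t}" if "t \<in> Z" for t using insert that by auto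
  then have "(\<Sum>t\<in>Z. w (card {s \<in> insert b Z. s < t})) = (\<Sum>t\<in>Z. w (card {s \<in> Z. s < t}))"
    by (intro sum.cong) auto
  ultimately show ?case using insert b by simp
qed simp

text \<open>The free weight \<open>a\<close> makes the bound linear in the random count, so that
  expectations can be taken term by term; \<open>a\<close> is optimised only afterwards.\<close>

lemma sqrt_le_AM:
  fixes x y a :: real
  assumes "0 \<le> x" "0 \<le> y" "0 < a"
  shows "2 * sqrt (x * y) \<le> a * x + y / a"
proof -
  have "sqrt (x * y) = sqrt (a * x) * sqrt (y / a)"
    using assms by (simp flip: real_sqrt_mult)
  moreover have "0 \<le> (sqrt (a * x) - sqrt (y / a))\<^sup>2" by simp
  ultimately show ?thesis using assms by (simp add: power2_diff)
qed

subsection \<open>Counts along a history\<close>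

lemma offer_snoc: "1 \<le> t \<Longrightarrow> t \<le> length h \<Longrightarrow> offer (h @ [x]) t = offer h t"
  by (cases t) (simp_all add: offer_def nth_append)

lemma choice_snoc: "1 \<le> t \<Longrightarrow> t \<le> length h \<Longrightarrow> choice (h @ [x]) t = choice h t"
  by (cases t) (simp_all add: choice_def nth_append)

lemma offer_snoc_last: "offer (h @ [x]) (Suc (length h)) = fst x"
  by (simp add: offer_def)

lemma choice_snoc_last: "choice (h @ [x]) (Suc (length h)) = snd x"
  by (simp add: choice_def)

lemma offer_take: "1 \<le> t \<Longrightarrow> t \<le> n \<Longrightarrow> offer (take n h) t = offer h t"
  by (simp add: offer_def)

lemma choice_take: "1 \<le> t \<Longrightarrow> t \<le> n \<Longrightarrow> choice (take n h) t = choice h t"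
  by (simp add: choice_def)

text \<open>Only strictly earlier choices matter for \<open>epoch_of\<close>, so one position past
  the end of \<open>h\<close> is allowed.\<close>

lemma epoch_of_snoc: "t \<le> Suc (length h) \<Longrightarrow> epoch_of (h @ [x]) t = epoch_of h t"
  unfolding epoch_of_def
  by (intro arg_cong[of _ _ "\<lambda>A. 1 + card A"]) (auto simp: choice_snoc)

lemma epoch_of_take: "t \<le> Suc n \<Longrightarrow> epoch_of (take n h) t = epoch_of h t"
  unfolding epoch_of_def
  by (intro arg_cong[of _ _ "\<lambda>A. 1 + card A"]) (auto simp: choice_take)

lemma epoch_of_Suc:
  assumes "1 \<le> t"
  shows "epoch_of h (Suc t) = epoch_of h t + of_bool (choice h t = 0)"
proof -
  have "{s \<in> {1..<Suc t}. choice h s = 0} =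
      {s \<in> {1..<t}. choice h s = 0} \<union> {s. s = t \<and> choice h t = 0}"
    using assms by (auto simp: less_Suc_eq)
  then show ?thesis unfolding epoch_of_def by (auto simp: card_insert_if)
qed

lemma epoch_of_1: "epoch_of h 1 = 1"
  by (simp add: epoch_of_def)

lemma epoch_of_ge_1: "1 \<le> epoch_of h t"
  by (simp add: epoch_of_def)

lemma epoch_of_le: "1 \<le> t \<Longrightarrow> epoch_of h t \<le> t"
proof -
  assume "1 \<le> t"
  have "card {s \<in> {1..<t}. choice h s = 0} \<le> card {1..<t}" by (intro card_mono) auto
  then show ?thesis using \<open>1 \<le> t\<close> by (simp add: epoch_of_def)
qed

lemma epoch_of_mono: "s \<le> t \<Longrightarrow> epoch_of h s \<le> epoch_of h t"
  unfolding epoch_of_def by (intro add_left_mono card_mono) auto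

lemma epoch_of_less: "1 \<le> s \<Longrightarrow> choice h s = 0 \<Longrightarrow> s < t \<Longrightarrow> epoch_of h s < epoch_of h t"
  using epoch_of_Suc[of s h] epoch_of_mono[of "Suc s" t h] by simp

lemma epoch_of_Suc_length: "epoch_of h (Suc (length h)) = Suc (completed_epochs h)"
  unfolding epoch_of_def completed_epochs_def atLeastLessThanSuc_atLeastAtMost by simp

section \<open>No-purchase times as representatives of the completed epochs\<close>

definition no_purchase_times :: "history \<Rightarrow> nat set" where
  "no_purchase_times h = {t \<in> {1..length h}. choice h t = 0}"

lemma finite_no_purchase_times: "finite (no_purchase_times h)"
  by (simp add: no_purchase_times_def)

lemma inj_on_epoch_of: "inj_on (epoch_of h) (no_purchase_times h)"
proof (rule linorder_inj_onI)
  fix s t assume "s < t" "s \<in> no_purchase_times h" "t \<in> no_purchase_times h"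
  then show "epoch_of h s \<noteq> epoch_of h t"
    using epoch_of_less[of s h t] by (auto simp: no_purchase_times_def)
qed auto

lemma epoch_of_no_purchase_times: "epoch_of h ` no_purchase_times h = {1..completed_epochs h}"
proof (rule card_subset_eq)
  show "epoch_of h ` no_purchase_times h \<subseteq> {1..completed_epochs h}"
  proof safe
    fix t assume "t \<in> no_purchase_times h"
    then have "epoch_of h t < epoch_of h (Suc (length h))"
      by (intro epoch_of_less) (auto simp: no_purchase_times_def)
    then show "epoch_of h t \<in> {1..completed_epochs h}"
      using epoch_of_ge_1[of h t] by (simp add: epoch_of_Suc_length)
  qed
  show "card (epoch_of h ` no_purchase_times h) = card {1..completed_epochs h}"
    using card_image[OF inj_on_epoch_of[of h]]
    by (simp add: completed_epochs_def no_purchase_times_def)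
qed simp

text \<open>Each completed epoch ends with exactly one no-purchase, so \<open>obs_count 0 i k\<close> counts the epochs
  up to \<open>k\<close> that offered \<open>i\<close>, and \<open>obs_count i i k\<close> the purchases of \<open>i\<close> in them.\<close>

definition obs_count :: "nat \<Rightarrow> nat \<Rightarrow> nat \<Rightarrow> history \<Rightarrow> nat" where
  "obs_count c i k h =
     card {t \<in> {1..length h}. epoch_of h t \<le> k \<and> i \<in> offer h t \<and> choice h t = c}"

lemma obs_count_Nil: "obs_count c i k [] = 0"
  by (simp add: obs_count_def)

lemma obs_count_snoc:
  "obs_count c i k (h @ [(S, d)]) =
     obs_count c i k h + of_bool (completed_epochs h < k \<and> i \<in> S \<and> d = c)"
proof -
  let ?h = "h @ [(S, d)]"
  let ?A = "\<lambda>h. {t \<in> {1..length h}. epoch_of h t \<le> k \<and> i \<in> offer h t \<and> choice h t = c}"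
  have "t \<in> ?A ?h \<longleftrightarrow> t \<in> ?A h \<union>
      {t. t = Suc (length h) \<and> completed_epochs h < k \<and> i \<in> S \<and> d = c}" for t
  proof (cases "t \<in> {1..length h}")
    case True
    then show ?thesis by (auto simp: epoch_of_snoc offer_snoc choice_snoc)
  next
    case False
    show ?thesis
    proof (cases "t = Suc (length h)")
      case True
      then show ?thesis
        by (simp add: epoch_of_snoc epoch_of_Suc_length offer_snoc_last choice_snoc_last Suc_le_eq)
    next
      case False
      then have "t \<notin> {1..length ?h}" using \<open>t \<notin> {1..length h}\<close> by auto
      then show ?thesis using False \<open>t \<notin> {1..length h}\<close> by blast
    qed
  qed
  then have "?A ?h = ?A h \<union> {t. t = Suc (length h) \<and> completed_epochs h < k \<and> i \<in> S \<and> d = c}"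
    by blast
  moreover have "finite (?A h)" "Suc (length h) \<notin> ?A h" by simp_all
  ultimately show ?thesis unfolding obs_count_def
    by (cases "completed_epochs h < k \<and> i \<in> S \<and> d = c") simp_all
qed

text \<open>Once \<open>k\<close> epochs are complete, every step of the epochs up to
  \<open>k\<close> lies in the prefix. Hence the counts on which a decision was based can be read
  off the final history.\<close>

lemma obs_count_take:
  assumes "n \<le> length h" "k \<le> completed_epochs (take n h)"
  shows "obs_count c i k (take n h) = obs_count c i k h"
proof -
  have "epoch_of h (Suc n) = Suc (completed_epochs (take n h))"
    using epoch_of_Suc_length[of "take n h"] assms(1) by (simp add: epoch_of_take min_absorb2)
  then have "t \<le> n" if "epoch_of h t \<le> k" for t
    using epoch_of_mono[of "Suc n" t h] assms(2) that by (cases "t \<le> n") auto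
  then have "{t \<in> {1..length (take n h)}. epoch_of (take n h) t \<le> k \<and>
        i \<in> offer (take n h) t \<and> choice (take n h) t = c} =
      {t \<in> {1..length h}. epoch_of h t \<le> k \<and> i \<in> offer h t \<and> choice h t = c}"
    using assms(1) by (fastforce simp: epoch_of_take offer_take choice_take)
  then show ?thesis unfolding obs_count_def by simp
qed

text \<open>The estimates read the offer at the first step of an epoch; under this condition it can
  be read at any step, in particular at the closing no-purchase.\<close>

definition constant_on_epochs :: "history \<Rightarrow> bool" where
  "constant_on_epochs h \<longleftrightarrow>
     (\<forall>t\<in>{1..<length h}. choice h t \<noteq> 0 \<longrightarrow> offer h (Suc t) = offer h t)"

lemma constant_on_epochs_take: "constant_on_epochs h \<Longrightarrow> constant_on_epochs (take n h)"
  unfolding constant_on_epochs_def by (auto simp: offer_take choice_take)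

lemma offer_eq_epoch_offer:
  assumes h: "constant_on_epochs h" and t: "t \<in> {1..length h}"
  shows "offer h t = epoch_offer h (epoch_of h t)"
proof -
  have same: "offer h s = offer h u"
    if "s \<le> u" "1 \<le> s" "u \<le> length h" "epoch_of h s = epoch_of h u" for s u
    using that
  proof (induction u rule: dec_induct)
    case (step u)
    have "epoch_of h s \<le> epoch_of h u" by (rule epoch_of_mono[OF step(1)])
    moreover have "epoch_of h (Suc u) = epoch_of h u + of_bool (choice h u = 0)"
      using step by (intro epoch_of_Suc) simp
    ultimately have e: "epoch_of h s = epoch_of h u" "choice h u \<noteq> 0"
      using step.prems(3) by (cases "choice h u = 0"; simp)+
    then have "offer h (Suc u) = offer h u"
      using h step unfolding constant_on_epochs_def by auto
    then show ?case using step e by simp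
  qed simp
  let ?E = "epoch_steps h (epoch_of h t)"
  have "finite ?E" "t \<in> ?E" using t by (auto simp: epoch_steps_def)
  then have "Min ?E \<in> ?E" "Min ?E \<le> t" by (auto intro: Min_in)
  then show ?thesis unfolding epoch_offer_def
    using same[of "Min ?E" t] t by (auto simp: epoch_steps_def)
qed

text \<open>The map \<open>epoch_of\<close> is a bijection from the no-purchase times with
  \<open>i\<close> on offer to the offering epochs. It is onto because each of the first
  \<open>k\<close> epochs is complete and so has a closing time.\<close>

lemma num_offers_eq_obs_count:
  assumes h: "constant_on_epochs h" and k: "k \<le> completed_epochs h"
  shows "num_offers h i k = obs_count 0 i k h"
proof -
  let ?A = "{t \<in> {1..length h}. epoch_of h t \<le> k \<and> i \<in> offer h t \<and> choice h t = 0}"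
  have "?A \<subseteq> no_purchase_times h" by (auto simp: no_purchase_times_def)
  then have "card (epoch_of h ` ?A) = card ?A"
    by (rule card_image[OF inj_on_subset[OF inj_on_epoch_of]])
  moreover have "epoch_of h ` ?A = offering_epochs h i k"
  proof (intro equalityI subsetI)
    fix l assume "l \<in> epoch_of h ` ?A"
    then show "l \<in> offering_epochs h i k"
      using offer_eq_epoch_offer[OF h] epoch_of_ge_1[of h] by (auto simp: offering_epochs_def)
  next
    fix l assume l: "l \<in> offering_epochs h i k"
    then have "l \<in> {1..completed_epochs h}" using k by (auto simp: offering_epochs_def)
    then obtain t where t: "t \<in> no_purchase_times h" "l = epoch_of h t"
      unfolding epoch_of_no_purchase_times[symmetric] by blast
    then have "i \<in> offer h t" "epoch_of h t \<le> k"
      using l offer_eq_epoch_offer[OF h, of t]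
      by (simp_all add: offering_epochs_def no_purchase_times_def)
    then have "t \<in> ?A" using t(1) by (simp add: no_purchase_times_def)
    then show "l \<in> epoch_of h ` ?A" using t(2) by blast
  qed
  ultimately show ?thesis by (simp add: num_offers_def obs_count_def)
qed

lemma sum_v_hat_eq_obs_count:
  assumes h: "constant_on_epochs h"
  shows "(\<Sum>\<tau>\<in>offering_epochs h i k. v_hat h i \<tau>) = real (obs_count i i k h)"
proof -
  let ?A = "{t \<in> {1..length h}. epoch_of h t \<le> k \<and> i \<in> offer h t \<and> choice h t = i}"
  let ?B = "\<lambda>\<tau>. {t \<in> epoch_steps h \<tau>. choice h t = i}"
  have v: "v_hat h i \<tau> = real (card (?B \<tau>))" for \<tau>
    unfolding v_hat_def by (simp add: of_bool_def sum.If_cases epoch_steps_def Int_def)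
  have "(\<Sum>\<tau>\<in>offering_epochs h i k. card (?B \<tau>)) = card (\<Union>\<tau>\<in>offering_epochs h i k. ?B \<tau>)"
    by (intro card_UN_disjoint[symmetric]) (auto simp: offering_epochs_def epoch_steps_def)
  also have "(\<Union>\<tau>\<in>offering_epochs h i k. ?B \<tau>) = ?A"
    using offer_eq_epoch_offer[OF h] epoch_of_ge_1[of h]
    by (auto simp: offering_epochs_def epoch_steps_def)
  finally show ?thesis unfolding v obs_count_def by (simp flip: of_nat_sum)
qed

lemma obs_count_0_le: "obs_count 0 i k h \<le> k"
proof -
  let ?A = "{t \<in> {1..length h}. epoch_of h t \<le> k \<and> i \<in> offer h t \<and> choice h t = 0}"
  have "?A \<subseteq> no_purchase_times h" by (auto simp: no_purchase_times_def)
  then have "card ?A = card (epoch_of h ` ?A)"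
    by (rule card_image[OF inj_on_subset[OF inj_on_epoch_of], symmetric])
  also have "\<dots> \<le> card {1..k}" using epoch_of_ge_1[of h] by (intro card_mono) auto
  finally show ?thesis by (simp add: obs_count_def)
qed

section \<open>Confidence bounds and decisions expressed through counts\<close>

definition ucb_of_counts :: "nat \<Rightarrow> nat \<Rightarrow> real \<Rightarrow> real \<Rightarrow> real" where
  "ucb_of_counts N k m n = (if n = 0 then 1 else
     m / n + sqrt (m / n * (48 * ln (sqrt (real N) * real k + 1) / n))
       + 48 * ln (sqrt (real N) * real k + 1) / n)"

lemma v_ucb_eq:
  assumes "constant_on_epochs h" "k \<le> completed_epochs h"
  shows "v_ucb N h i k = ucb_of_counts N k (obs_count i i k h) (obs_count 0 i k h)"
  using num_offers_eq_obs_count[OF assms] sum_v_hat_eq_obs_count[OF assms(1)]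
  by (simp add: v_ucb_def ucb_of_counts_def v_bar_def)

definition follows_algorithm :: "nat \<Rightarrow> nat set set \<Rightarrow> (nat \<Rightarrow> real) \<Rightarrow> history \<Rightarrow> bool" where
  "follows_algorithm N F r h \<longleftrightarrow>
     (\<forall>t<length h. algorithm_may_offer N F r (take t h) (offer h (Suc t)))"

lemma follows_algorithm_snoc:
  "follows_algorithm N F r (h @ [(S, c)]) \<longleftrightarrow>
     follows_algorithm N F r h \<and> algorithm_may_offer N F r h S"
proof -
  have "(\<forall>t<length (h @ [(S, c)]). P t) \<longleftrightarrow> (\<forall>t<length h. P t) \<and> P (length h)" for P
    by (auto simp: less_Suc_eq)
  then show ?thesis unfolding follows_algorithm_def
    by (simp add: offer_snoc_last) (auto simp: offer_snoc)
qed

lemma follows_algorithm_constant_on_epochs: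
  assumes "follows_algorithm N F r h"
  shows "constant_on_epochs h"
  unfolding constant_on_epochs_def
proof (intro ballI impI)
  fix t assume t: "t \<in> {1..<length h}" "choice h t \<noteq> 0"
  then have "algorithm_may_offer N F r (take t h) (offer h (Suc t))"
    using assms by (auto simp: follows_algorithm_def)
  moreover have "length (take t h) = t" "take t h \<noteq> []" using t by auto
  moreover have "choice (take t h) t = choice h t" "offer (take t h) t = offer h t"
    using t by (simp_all add: choice_take offer_take)
  ultimately show "offer h (Suc t) = offer h t"
    using t by (simp add: algorithm_may_offer_def)
qed

text \<open>At the start of an epoch this is the rule of the algorithm, with the counts of the
  prefix replaced by those of \<open>h\<close>. Within an epoch neither the offer nor
  \<open>k\<close> changes. The shift by 1 reflects that an epoch uses the bounds computed at the
  end of the previous one.\<close>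

lemma follows_algorithm_is_arg_max:
  assumes h: "follows_algorithm N F r h" and t: "t \<in> {1..length h}"
  defines "k \<equiv> epoch_of h t - 1"
  shows "is_arg_max (revenue r (\<lambda>i. ucb_of_counts N k (obs_count i i k h) (obs_count 0 i k h)))
    (\<lambda>S. S \<in> F) (offer h t)"
proof -
  let ?u = "\<lambda>k i. ucb_of_counts N k (obs_count i i k h) (obs_count 0 i k h)"
  have const: "constant_on_epochs h" using h by (rule follows_algorithm_constant_on_epochs)
  have start: "is_arg_max (revenue r (?u (epoch_of h (Suc t) - 1))) (\<lambda>S. S \<in> F) (offer h (Suc t))"
    if t: "t < length h" "t = 0 \<or> choice h t = 0" for t
  proof -
    let ?k = "completed_epochs (take t h)"
    have k: "epoch_of h (Suc t) - 1 = ?k"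
      using t epoch_of_Suc_length[of "take t h"] by (simp add: epoch_of_take min_absorb2)
    have "take t h = [] \<or> choice (take t h) (length (take t h)) = 0"
      using t by (cases "t = 0") (auto simp: choice_take min_absorb2)
    moreover have "algorithm_may_offer N F r (take t h) (offer h (Suc t))"
      using h t by (simp add: follows_algorithm_def)
    ultimately have "is_arg_max (revenue r (\<lambda>i. v_ucb N (take t h) i ?k)) (\<lambda>S. S \<in> F) (offer h (Suc t))"
      by (simp add: algorithm_may_offer_def)
    moreover have "v_ucb N (take t h) i ?k = ?u ?k i" for i
      using v_ucb_eq[OF constant_on_epochs_take[OF const, of t], of ?k N i] t
      by (simp add: obs_count_take)
    ultimately show ?thesis unfolding k by simp
  qed
  have "is_arg_max (revenue r (?u (epoch_of h t - 1))) (\<lambda>S. S \<in> F) (offer h t)"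
    if "1 \<le> t" "t \<le> length h" for t
    using that
  proof (induction t rule: dec_induct)
    case base
    then show ?case using start[of 0] by (simp add: Suc_le_eq)
  next
    case (step t)
    show ?case
    proof (cases "choice h t = 0")
      case True
      then show ?thesis using start[of t] step by simp
    next
      case False
      then show ?thesis
        using step const epoch_of_Suc[of t h] unfolding constant_on_epochs_def by simp
    qed
  qed
  then show ?thesis using t by (simp add: k_def)
qed

subsection \<open>Expectations over histories\<close>

lemma expectation_bind_le:
  fixes g :: "'b \<Rightarrow> real"
  assumes p: "finite (set_pmf p)" and f: "\<And>x. x \<in> set_pmf p \<Longrightarrow> finite (set_pmf (f x))"
    and le: "\<And>x. x \<in> set_pmf p \<Longrightarrow> measure_pmf.expectation (f x) g \<le> G x"
  shows "measure_pmf.expectation (bind_pmf p f) g \<le> measure_pmf.expectation p G"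
proof -
  have "measure_pmf.expectation (bind_pmf p f) g
      = (\<Sum>x\<in>set_pmf p. pmf p x *\<^sub>R measure_pmf.expectation (f x) g)"
    by (rule pmf_expectation_bind) (use p f in auto)
  also have "\<dots> \<le> (\<Sum>x\<in>set_pmf p. pmf p x * G x)"
    by (intro sum_mono) (simp add: le mult_left_mono)
  also have "\<dots> = measure_pmf.expectation p G"
    by (subst integral_measure_pmf_real[OF p]) (auto simp: mult.commute)
  finally show ?thesis .
qed

section \<open>The bandit model and the law of its histories\<close>

locale mnl_bandit =
  fixes N :: nat and F :: "nat set set" and r v :: "nat \<Rightarrow> real" and Sstar :: "nat set"
    and \<pi> :: policy
  assumes N_ge_1: "1 \<le> N"
    and F_subset: "S \<in> F \<Longrightarrow> S \<subseteq> {1..N}"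
    and F_down: "S \<in> F \<Longrightarrow> Q \<subseteq> S \<Longrightarrow> Q \<in> F"
    and r_bounds: "i \<in> {1..N} \<Longrightarrow> 0 \<le> r i \<and> r i \<le> 1"
    and v_0: "v 0 = 1"
    and v_bounds: "i \<in> {1..N} \<Longrightarrow> 0 < v i \<and> v i \<le> 1"
    and Sstar: "is_arg_max (revenue r v) (\<lambda>S. S \<in> F) Sstar"
    and algorithm: "algorithm_policy N F r \<pi>"
begin

abbreviation V :: "nat set \<Rightarrow> real" where "V S \<equiv> \<Sum>i\<in>S. v i"

abbreviation E :: "nat \<Rightarrow> (history \<Rightarrow> real) \<Rightarrow> real" where
  "E T f \<equiv> measure_pmf.expectation (history_pmf v \<pi> T) f"

abbreviation gap :: "nat set \<Rightarrow> real" where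
  "gap S \<equiv> revenue r v Sstar - revenue r v S"

lemma finite_feasible: "S \<in> F \<Longrightarrow> finite S"
  using F_subset finite_subset by blast

lemma zero_notin: "S \<in> F \<Longrightarrow> 0 \<notin> S"
  using F_subset by fastforce

lemma v_pos: "S \<in> F \<Longrightarrow> i \<in> S \<Longrightarrow> 0 < v i"
  using F_subset v_bounds by blast

lemma V_nonneg: "S \<in> F \<Longrightarrow> 0 \<le> V S"
  using v_pos by (intro sum_nonneg) (auto intro: less_imp_le)

lemma V_le: "S \<in> F \<Longrightarrow> V S \<le> N"
proof -
  assume S: "S \<in> F"
  have "V S \<le> (\<Sum>i\<in>S. 1)" using F_subset[OF S] v_bounds by (intro sum_mono) auto
  also have "\<dots> = card S" by simp
  also have "\<dots> \<le> card {1..N}" using F_subset[OF S] by (intro of_nat_mono card_mono) auto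
  finally show ?thesis by simp
qed

lemma pmf_choice:
  "S \<in> F \<Longrightarrow> pmf (mnl_choice v S) i = (if i \<in> S \<union> {0} then v i / (1 + V S) else 0)"
proof -
  assume S: "S \<in> F"
  have "v i > 0" if "i \<in> {0..N}" for i using that v_bounds[of i] v_0 by (cases "i = 0") auto
  from pmf_mnl_choice[OF F_subset[OF S] this] show ?thesis by (simp add: v_0)
qed

lemma set_pmf_choice: "S \<in> F \<Longrightarrow> set_pmf (mnl_choice v S) \<subseteq> insert 0 S"
  by (auto simp: set_pmf_iff pmf_choice split: if_splits)

lemma expectation_choice:
  assumes "S \<in> F"
  shows "measure_pmf.expectation (mnl_choice v S) f = (f 0 + (\<Sum>i\<in>S. v i * f i)) / (1 + V S)"
proof -
  have "measure_pmf.expectation (mnl_choice v S) f =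
      (\<Sum>i\<in>insert 0 S. f i * pmf (mnl_choice v S) i)"
    using set_pmf_choice[OF assms] finite_feasible[OF assms]
    by (intro integral_measure_pmf_real) auto
  also have "\<dots> = (f 0 + (\<Sum>i\<in>S. v i * f i)) / (1 + V S)"
    using finite_feasible[OF assms] zero_notin[OF assms] assms
    by (simp add: pmf_choice v_0 add_divide_distrib sum_divide_distrib mult.commute)
  finally show ?thesis .
qed

lemma offered_feasible:
  assumes "follows_algorithm N F r h" "S \<in> set_pmf (\<pi> h)"
  shows "S \<in> F"
proof -
  have S: "algorithm_may_offer N F r h S"
    using algorithm assms(2) by (auto simp: algorithm_policy_def)
  show ?thesis
  proof (cases "h = [] \<or> choice h (length h) = 0")
    case True
    then show ?thesis using S by (simp add: algorithm_may_offer_def is_arg_max_def)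
  next
    case False
    then have "length h \<in> {1..length h}" by (simp add: Suc_le_eq)
    from follows_algorithm_is_arg_max[OF assms(1) this] False S
    show ?thesis by (simp add: algorithm_may_offer_def is_arg_max_def)
  qed
qed

lemma offer_in_F:
  assumes "follows_algorithm N F r h" "t \<in> {1..length h}"
  shows "offer h t \<in> F"
  using follows_algorithm_is_arg_max[OF assms] by (simp add: is_arg_max_def)

lemma history_support:
  "h \<in> set_pmf (history_pmf v \<pi> t) \<Longrightarrow> length h = t \<and> follows_algorithm N F r h"
proof (induction t arbitrary: h)
  case 0
  then show ?case by (simp add: follows_algorithm_def)
next
  case (Suc t)
  then obtain h' S c where h': "h' \<in> set_pmf (history_pmf v \<pi> t)" "S \<in> set_pmf (\<pi> h')"
    "h = h' @ [(S, c)]" by auto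
  then show ?case using Suc.IH[OF h'(1)] algorithm
    by (auto simp: follows_algorithm_snoc algorithm_policy_def)
qed

lemma finite_policy:
  assumes "h \<in> set_pmf (history_pmf v \<pi> t)"
  shows "finite (set_pmf (\<pi> h))"
proof (rule finite_subset)
  show "set_pmf (\<pi> h) \<subseteq> Pow {1..N}"
    using offered_feasible F_subset history_support[OF assms] by blast
qed simp

lemma finite_choice: "S \<in> F \<Longrightarrow> finite (set_pmf (mnl_choice v S))"
  using set_pmf_choice finite_feasible finite_subset by blast

lemma finite_history: "finite (set_pmf (history_pmf v \<pi> t))"
proof (induction t)
  case (Suc t)
  have "finite (set_pmf (mnl_choice v S))" if "h \<in> set_pmf (history_pmf v \<pi> t)" "S \<in> set_pmf (\<pi> h)" for h S
    using that history_support[OF that(1)] offered_feasible finite_choice by blast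
  then show ?case using Suc finite_policy by simp
qed simp

text \<open>Feasible offers and the choices from them form finite sets, so expectations of arbitrary
  functions of the history are finite sums.\<close>

lemma integrable_history [simp]:
  fixes f :: "history \<Rightarrow> real"
  shows "integrable (measure_pmf (history_pmf v \<pi> t)) f"
  by (rule integrable_measure_pmf_finite[OF finite_history])

lemma E_mono:
  assumes "\<And>h. follows_algorithm N F r h \<Longrightarrow> length h = T \<Longrightarrow> f h \<le> g h"
  shows "E T f \<le> E T g"
  using history_support[of _ T] assms by (intro integral_mono_AE) (auto simp: AE_measure_pmf_iff)

text \<open>The supermartingale principle. The hypothesis is the one-step inequality multiplied by
  \<open>1 + V S\<close>, the no-purchase having weight 1 and product \<open>i\<close> weight
  \<open>v i\<close>. It is required for each feasible \<open>S\<close> separately, so any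
  randomised tie-breaking is covered.\<close>

lemma expectation_history_le:
  assumes step: "\<And>h S. follows_algorithm N F r h \<Longrightarrow> S \<in> F \<Longrightarrow>
    G (h @ [(S, 0)]) + (\<Sum>i\<in>S. v i * G (h @ [(S, i)])) \<le> (1 + V S) * G h"
  shows "E T G \<le> G []"
proof (induction T)
  case (Suc t)
  have "E (Suc t) G \<le> E t G"
    unfolding history_pmf.simps(2)
  proof (rule expectation_bind_le)
    fix h assume h: "h \<in> set_pmf (history_pmf v \<pi> t)"
    then have follows: "follows_algorithm N F r h" using history_support by blast
    note finite_policy[OF h, simp]
    have [simp]: "finite (set_pmf (mnl_choice v S))" if "S \<in> set_pmf (\<pi> h)" for S
      using offered_feasible[OF follows that] finite_choice by blast
    show "finite (set_pmf (\<pi> h \<bind> (\<lambda>S. map_pmf (\<lambda>c. h @ [(S, c)]) (mnl_choice v S))))"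
      by simp
    have "measure_pmf.expectation (\<pi> h \<bind> (\<lambda>S. map_pmf (\<lambda>c. h @ [(S, c)]) (mnl_choice v S))) G
        \<le> measure_pmf.expectation (\<pi> h) (\<lambda>S. G h)"
    proof (rule expectation_bind_le)
      fix S assume "S \<in> set_pmf (\<pi> h)"
      then have S: "S \<in> F" using offered_feasible follows by blast
      have "0 < 1 + V S" using V_nonneg[OF S] by simp
      then show "measure_pmf.expectation (map_pmf (\<lambda>c. h @ [(S, c)]) (mnl_choice v S)) G \<le> G h"
        using step[OF follows S] by (simp add: expectation_choice[OF S] divide_le_eq mult.commute)
    qed simp_all
    then show "measure_pmf.expectation
        (\<pi> h \<bind> (\<lambda>S. map_pmf (\<lambda>c. h @ [(S, c)]) (mnl_choice v S))) G \<le> G h" by simp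
  qed (rule finite_history)
  then show ?case using Suc by simp
qed simp

section \<open>Supermartingales for the regret, the offered weights and the counts\<close>

lemma sum_no_purchase_times_snoc:
  "(\<Sum>t\<in>no_purchase_times (h @ [(S, c)]). \<phi> (offer (h @ [(S, c)]) t)) =
     (\<Sum>t\<in>no_purchase_times h. \<phi> (offer h t)) + (if c = 0 then \<phi> S else (0 :: real))"
proof -
  have "no_purchase_times (h @ [(S, c)]) =
      no_purchase_times h \<union> (if c = 0 then {Suc (length h)} else {})"
    by (auto simp: no_purchase_times_def choice_snoc choice_snoc_last le_Suc_eq)
  moreover have "(\<Sum>t\<in>no_purchase_times h. \<phi> (offer (h @ [(S, c)]) t)) =
      (\<Sum>t\<in>no_purchase_times h. \<phi> (offer h t))"
    by (intro sum.cong) (auto simp: no_purchase_times_def offer_snoc)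
  moreover have "Suc (length h) \<notin> no_purchase_times h" by (simp add: no_purchase_times_def)
  ultimately show ?thesis using finite_no_purchase_times[of h]
    by (cases "c = 0") (simp_all add: offer_snoc_last)
qed

lemma regret_eq: "regret r v Sstar \<pi> T = E T (\<lambda>h. \<Sum>t=1..T. gap (offer h t))"
  unfolding regret_def by simp

text \<open>The two cumulative sums differ by a martingale: a step adds \<open>gap S\<close> to the
  first, and \<open>gap S * (1 + V S)\<close> with probability \<open>1 / (1 + V S)\<close> to the
  second.\<close>

lemma regret_le_no_purchase_sum:
  "regret r v Sstar \<pi> T \<le> E T (\<lambda>h. \<Sum>t\<in>no_purchase_times h. gap (offer h t) * (1 + V (offer h t)))"
proof -
  let ?A = "\<lambda>h. \<Sum>t=1..length h. gap (offer h t)"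
  let ?B = "\<lambda>h. \<Sum>t\<in>no_purchase_times h. gap (offer h t) * (1 + V (offer h t))"
  have "E T (\<lambda>h. ?A h - ?B h) \<le> ?A [] - ?B []"
  proof (rule expectation_history_le)
    fix h S assume S: "S \<in> F"
    have A: "?A (h @ [(S, c)]) = ?A h + gap S" for c
      by (simp add: offer_snoc_last) (intro sum.cong, auto simp: offer_snoc)
    have B: "?B (h @ [(S, c)]) = ?B h + (if c = 0 then gap S * (1 + V S) else 0)" for c
      by (rule sum_no_purchase_times_snoc)
    have "(\<Sum>i\<in>S. v i * (?A (h @ [(S, i)]) - ?B (h @ [(S, i)]))) =
        (\<Sum>i\<in>S. v i * (?A h - ?B h + gap S))"
      using zero_notin[OF S] unfolding A B by (intro sum.cong) auto
    also have "\<dots> = V S * (?A h - ?B h + gap S)" by (simp add: sum_distrib_right)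
    finally show "?A (h @ [(S, 0)]) - ?B (h @ [(S, 0)]) +
        (\<Sum>i\<in>S. v i * (?A (h @ [(S, i)]) - ?B (h @ [(S, i)]))) \<le> (1 + V S) * (?A h - ?B h)"
      unfolding A B by (simp add: algebra_simps)
  qed
  then have "E T ?A \<le> E T ?B" by (simp add: no_purchase_times_def)
  moreover have "regret r v Sstar \<pi> T = E T ?A"
    unfolding regret_eq
    using history_support[of _ T] by (intro integral_cong_AE) (auto simp: AE_measure_pmf_iff)
  ultimately show ?thesis by simp
qed

text \<open>A step adds \<open>V S / (1 + V S)\<close> in the mean, the probability of a purchase
  and thus at most 1. Subtracting the length therefore leaves a supermartingale.\<close>

lemma expectation_sum_V_le: "E T (\<lambda>h. \<Sum>t\<in>no_purchase_times h. V (offer h t)) \<le> T"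
proof -
  let ?B = "\<lambda>h. \<Sum>t\<in>no_purchase_times h. V (offer h t)"
  have "E T (\<lambda>h. ?B h - length h) \<le> ?B [] - length ([] :: history)"
  proof (rule expectation_history_le)
    fix h S assume S: "S \<in> F"
    have B: "?B (h @ [(S, c)]) = ?B h + (if c = 0 then V S else 0)" for c
      by (rule sum_no_purchase_times_snoc)
    have "(\<Sum>i\<in>S. v i * (?B (h @ [(S, i)]) - length (h @ [(S, i)]))) =
        (\<Sum>i\<in>S. v i * (?B h - length h - 1))"
      using zero_notin[OF S] unfolding B by (intro sum.cong) auto
    also have "\<dots> = V S * (?B h - length h - 1)" by (simp add: sum_distrib_right)
    finally show "?B (h @ [(S, 0)]) - length (h @ [(S, 0)]) +
        (\<Sum>i\<in>S. v i * (?B (h @ [(S, i)]) - length (h @ [(S, i)]))) \<le> (1 + V S) * (?B h - length h)"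
      unfolding B by (simp add: algebra_simps)
  qed
  then have "E T ?B \<le> E T (\<lambda>h. real (length h))" by (simp add: no_purchase_times_def)
  also have "\<dots> = E T (\<lambda>h. real T)"
    using history_support[of _ T] by (intro integral_cong_AE) (auto simp: AE_measure_pmf_iff)
  finally show ?thesis by simp
qed

text \<open>A step in one of the first \<open>k\<close> epochs with \<open>i\<close> on offer
  multiplies the mean by \<open>(exp (- b) + V S + v i * (exp a - 1)) / (1 + V S)\<close>, which
  \<open>exponent_pair\<close> bounds by 1. All other steps leave both counts unchanged.\<close>

lemma expectation_exp_le_1:
  assumes ab: "exponent_pair (v i) a b" and i: "i \<noteq> 0"
  shows "E T (\<lambda>h. exp (a * obs_count i i k h - b * obs_count 0 i k h)) \<le> 1"
proof -
  let ?G = "\<lambda>h. exp (a * obs_count i i k h - b * obs_count 0 i k h)"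
  have "E T ?G \<le> ?G []"
  proof (rule expectation_history_le)
    fix h S assume S: "S \<in> F"
    show "?G (h @ [(S, 0)]) + (\<Sum>j\<in>S. v j * ?G (h @ [(S, j)])) \<le> (1 + V S) * ?G h"
    proof (cases "completed_epochs h < k \<and> i \<in> S")
      case False
      then have eq: "?G (h @ [(S, c)]) = ?G h" for c by (auto simp: obs_count_snoc)
      show ?thesis unfolding eq by (simp add: distrib_right flip: sum_distrib_right)
    next
      case True
      have 0: "?G (h @ [(S, 0)]) = ?G h * exp (- b)"
        using True i by (simp add: obs_count_snoc algebra_simps flip: exp_add)
      \<comment> \<open>Writing the factor as 1 plus a correction at \<open>j = i\<close> isolates
        the common part \<open>V S\<close> of the sum.\<close>
      have j: "?G (h @ [(S, j)]) = ?G h * (1 + of_bool (j = i) * (exp a - 1))" if "j \<in> S" for j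
        using True i that zero_notin[OF S]
        by (cases "j = i"; cases "j = 0") (auto simp: obs_count_snoc algebra_simps simp flip: exp_add)
      have "(\<Sum>j\<in>S. v j * ?G (h @ [(S, j)])) =
          (\<Sum>j\<in>S. ?G h * (v j + of_bool (j = i) * (v j * (exp a - 1))))"
      proof (rule sum.cong)
        fix l assume "l \<in> S"
        show "v l * ?G (h @ [(S, l)]) = ?G h * (v l + of_bool (l = i) * (v l * (exp a - 1)))"
          unfolding j[OF \<open>l \<in> S\<close>] by (simp add: algebra_simps)
      qed simp
      also have "\<dots> = ?G h * (V S + (\<Sum>j\<in>S. of_bool (j = i) * (v j * (exp a - 1))))"
        by (simp only: sum_distrib_left[symmetric] sum.distrib)
      also have "(\<Sum>j\<in>S. of_bool (j = i) * (v j * (exp a - 1))) = v i * (exp a - 1)"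
        using True finite_feasible[OF S] by (simp add: of_bool_def if_distrib[of "\<lambda>x. x * _"] sum.delta' cong: if_cong)
      finally have "?G (h @ [(S, 0)]) + (\<Sum>j\<in>S. v j * ?G (h @ [(S, j)])) =
          ?G h * (exp (- b) + V S + v i * (exp a - 1))"
        unfolding 0 by (simp add: algebra_simps)
      also have "\<dots> \<le> ?G h * (1 + V S)"
        using ab by (intro mult_left_mono) (auto simp: exponent_pair_def)
      finally show ?thesis by (simp add: mult.commute)
    qed
  qed
  then show ?thesis by (simp add: obs_count_Nil)
qed

subsection \<open>Optimism and the regret bound\<close>

abbreviation opt_revenue :: real where "opt_revenue \<equiv> revenue r v Sstar"

lemma Sstar_in_F: "Sstar \<in> F"
  using Sstar by (simp add: is_arg_max_def)

lemma revenue_le_opt: "S \<in> F \<Longrightarrow> revenue r v S \<le> opt_revenue"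
  using Sstar by (auto simp: is_arg_max_def not_less)

lemma revenue_eq: "S \<in> F \<Longrightarrow> revenue r v S * (1 + V S) = (\<Sum>i\<in>S. r i * v i)"
  using V_nonneg[of S] by (simp add: revenue_def)

lemma revenue_bounds:
  assumes S: "S \<in> F"
  shows "0 \<le> revenue r v S" "revenue r v S \<le> 1"
proof -
  have "0 \<le> r i * v i \<and> r i * v i \<le> v i" if "i \<in> S" for i
    using that F_subset[OF S] r_bounds[of i] v_bounds[of i] by (auto intro: mult_left_le_one_le)
  then have "0 \<le> (\<Sum>i\<in>S. r i * v i)" "(\<Sum>i\<in>S. r i * v i) \<le> V S"
    by (auto intro: sum_nonneg sum_mono)
  then show "0 \<le> revenue r v S" "revenue r v S \<le> 1"
    using V_nonneg[OF S] by (auto simp: revenue_def divide_le_eq)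
qed

text \<open>The price of an epoch in which some confidence bound fails.\<close>

lemma gap_le_crude:
  assumes "S \<in> F"
  shows "gap S * (1 + V S) \<le> real N + 1"
proof -
  have "gap S * (1 + V S) \<le> 1 * (1 + V S)"
    using revenue_bounds[OF assms] revenue_bounds[OF Sstar_in_F] V_nonneg[OF assms]
    by (intro mult_right_mono) auto
  then show ?thesis using V_le[OF assms] by simp
qed

text \<open>Dropping \<open>i\<close> from \<open>Sstar\<close> leaves a feasible set of no larger
  revenue. Subtracting its inequality from the identity for \<open>Sstar\<close> leaves
  \<open>opt_revenue * v i \<le> r i * v i\<close>.\<close>

lemma opt_revenue_le_r:
  assumes i: "i \<in> Sstar"
  shows "opt_revenue \<le> r i"
proof -
  let ?Q = "Sstar - {i}"
  have Q: "?Q \<in> F" by (rule F_down[OF Sstar_in_F]) auto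
  have fin: "finite Sstar" using finite_feasible[OF Sstar_in_F] .
  have "(\<Sum>j\<in>?Q. r j * v j) \<le> opt_revenue * (1 + V ?Q)"
    using revenue_le_opt[OF Q] V_nonneg[OF Q]
    by (subst revenue_eq[OF Q, symmetric]) (intro mult_right_mono, auto)
  moreover have "(\<Sum>j\<in>Sstar. r j * v j) = r i * v i + (\<Sum>j\<in>?Q. r j * v j)" "V Sstar = v i + V ?Q"
    by (rule sum.remove[OF fin i])+
  ultimately have "opt_revenue * v i \<le> r i * v i"
    using revenue_eq[OF Sstar_in_F] by (simp add: algebra_simps)
  then show ?thesis using v_pos[OF Sstar_in_F i] by simp
qed

text \<open>Raising \<open>v\<close> to \<open>u\<close> increases the sum of
  \<open>(r i - opt_revenue) * v i\<close> over \<open>Sstar\<close>, where all coefficients are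
  nonnegative; hence the optimistic revenue of \<open>Sstar\<close>, and so that of
  \<open>S\<close>, is at least \<open>opt_revenue\<close>. Passing back from \<open>u\<close> to
  \<open>v\<close> on \<open>S\<close> costs the sum of
  \<open>(r i - opt_revenue) * (u i - v i)\<close>, whose coefficients may be negative there but are
  at most 1.\<close>

lemma gap_le_optimism:
  assumes u: "\<And>i. i \<in> {1..N} \<Longrightarrow> v i \<le> u i"
    and S: "is_arg_max (revenue r u) (\<lambda>S. S \<in> F) S"
  shows "gap S * (1 + V S) \<le> (\<Sum>i\<in>S. u i - v i)"
proof -
  have SF: "S \<in> F" using S by (simp add: is_arg_max_def)
  have u0: "0 \<le> (\<Sum>i\<in>A. u i)" if "A \<in> F" for A
    using F_subset[OF that] u v_pos[OF that] by (intro sum_nonneg) (meson less_imp_le order_trans subsetD)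
  have "(\<Sum>i\<in>Sstar. (r i - opt_revenue) * v i) \<le> (\<Sum>i\<in>Sstar. (r i - opt_revenue) * u i)"
    using opt_revenue_le_r u F_subset[OF Sstar_in_F] by (intro sum_mono mult_left_mono) auto
  moreover have "(\<Sum>i\<in>Sstar. (r i - opt_revenue) * v i) = opt_revenue"
    using revenue_eq[OF Sstar_in_F]
    by (simp add: left_diff_distrib sum_subtractf algebra_simps flip: sum_distrib_left sum_distrib_right)
  ultimately have "opt_revenue * (1 + (\<Sum>i\<in>Sstar. u i)) \<le> (\<Sum>i\<in>Sstar. r i * u i)"
    by (simp add: left_diff_distrib sum_subtractf algebra_simps flip: sum_distrib_left sum_distrib_right)
  then have "opt_revenue \<le> revenue r u Sstar"
    using u0[OF Sstar_in_F] by (simp add: revenue_def le_divide_eq)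
  also have "\<dots> \<le> revenue r u S"
    using S Sstar_in_F by (auto simp: is_arg_max_def not_less)
  finally have "opt_revenue * (1 + (\<Sum>i\<in>S. u i)) \<le> (\<Sum>i\<in>S. r i * u i)"
    using u0[OF SF] by (simp add: revenue_def le_divide_eq)
  then have "gap S * (1 + V S) \<le> (\<Sum>i\<in>S. r i * u i) - (\<Sum>i\<in>S. r i * v i)
      - opt_revenue * ((\<Sum>i\<in>S. u i) - V S)"
    using revenue_eq[OF SF] by (simp add: algebra_simps)
  also have "\<dots> = (\<Sum>i\<in>S. (r i - opt_revenue) * (u i - v i))"
    by (simp add: algebra_simps sum.distrib sum_subtractf flip: sum_distrib_left sum_distrib_right)
  also have "\<dots> \<le> (\<Sum>i\<in>S. 1 * (u i - v i))"
  proof (intro sum_mono mult_right_mono)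
    fix i assume "i \<in> S"
    then have "i \<in> {1..N}" using F_subset[OF SF] by blast
    then show "r i - opt_revenue \<le> 1" "0 \<le> u i - v i"
      using r_bounds[of i] u[of i] revenue_bounds[OF Sstar_in_F] by auto
  qed
  finally show ?thesis by simp
qed

section \<open>Failure of the confidence bounds\<close>

definition logf :: "nat \<Rightarrow> real" where "logf k = ln (sqrt (real N) * real k + 1)"

lemma logf_pos: "1 \<le> k \<Longrightarrow> 0 < logf k"
  unfolding logf_def using N_ge_1 by (intro ln_gt_zero) simp

lemma logf_mono: "j \<le> k \<Longrightarrow> logf j \<le> logf k"
  unfolding logf_def by (subst ln_le_cancel_iff) (auto intro!: mult_left_mono add_nonneg_pos)

text \<open>The cubic decay survives a union over \<open>N\<close> products and \<open>k\<close>
  candidate counts, and what remains is summable over \<open>k\<close>.\<close>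

lemma exp_minus_3_logf_le:
  assumes "1 \<le> k"
  shows "exp (- 3 * logf k) \<le> 1 / (real N * real k ^ 3)"
proof -
  let ?y = "sqrt (real N) * real k + 1"
  have y: "0 < ?y" by (simp add: add_nonneg_pos)
  have "exp (- 3 * logf k) = 1 / ?y ^ 3"
    using y exp_of_nat_mult[of 3 "logf k"] by (simp add: exp_minus logf_def divide_inverse)
  also have "\<dots> \<le> 1 / (real N * real k ^ 3)"
  proof (rule divide_left_mono)
    have "real N = sqrt (real N) ^ 2" by simp
    also have "\<dots> \<le> sqrt (real N) ^ 3" using N_ge_1 by (intro power_increasing) auto
    finally have "real N * real k ^ 3 \<le> sqrt (real N) ^ 3 * real k ^ 3" by (rule mult_right_mono) simp
    also have "\<dots> = (sqrt (real N) * real k) ^ 3" by (simp add: power_mult_distrib)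
    also have "\<dots> \<le> ?y ^ 3" by (intro power_mono) auto
    finally show "real N * real k ^ 3 \<le> ?y ^ 3" .
    show "0 < ?y ^ 3 * (real N * real k ^ 3)" using y N_ge_1 assms by simp
  qed simp
  finally show ?thesis .
qed

definition ucb :: "nat \<Rightarrow> history \<Rightarrow> nat \<Rightarrow> real" where
  "ucb k h i = ucb_of_counts N k (obs_count i i k h) (obs_count 0 i k h)"

text \<open>The width of the confidence interval. \<open>L\<close> is a separate argument so that
  \<open>logf k\<close> can be replaced by the uniform \<open>logf T\<close>; the value 1 at
  \<open>n = 0\<close> covers the default bound of a product not yet offered.\<close>

definition bonus :: "real \<Rightarrow> nat \<Rightarrow> nat \<Rightarrow> real" where
  "bonus L i n = (if n = 0 then 1 else 15 * sqrt (v i * L / n) + 101 * L / n)"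

definition bad :: "nat \<Rightarrow> history \<Rightarrow> bool" where
  "bad k h \<longleftrightarrow> (\<exists>i\<in>{1..N}. obs_count 0 i k h \<noteq> 0 \<and>
     \<not> (v i \<le> ucb k h i \<and> ucb k h i \<le> v i + bonus (logf k) i (obs_count 0 i k h)))"

lemma not_bad_0: "\<not> bad 0 h"
  using obs_count_0_le[of _ 0 h] by (auto simp: bad_def)

lemma not_bad_bounds:
  assumes "\<not> bad k h" "i \<in> {1..N}"
  shows "v i \<le> ucb k h i" "ucb k h i - v i \<le> bonus (logf k) i (obs_count 0 i k h)"
proof -
  have "v i \<le> ucb k h i \<and> ucb k h i - v i \<le> bonus (logf k) i (obs_count 0 i k h)"
  proof (cases "obs_count 0 i k h = 0")
    \<comment> \<open>The default bound 1 is valid since \<open>0 < v i \<le> 1\<close>, and its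
      error is below 1.\<close>
    case True
    then show ?thesis using v_bounds[OF assms(2)] by (simp add: ucb_def ucb_of_counts_def bonus_def)
  next
    case False
    then have "v i \<le> ucb k h i \<and> ucb k h i \<le> v i + bonus (logf k) i (obs_count 0 i k h)"
      using assms unfolding bad_def by blast
    then show ?thesis by linarith
  qed
  then show "v i \<le> ucb k h i" "ucb k h i - v i \<le> bonus (logf k) i (obs_count 0 i k h)" by auto
qed

text \<open>The number of offers is random, but the exponents must be constants. So each candidate
  value \<open>n\<close> gets its own variable \<open>X i n k\<close>, and on a failure the one
  whose \<open>n\<close> equals the actual count is at least 1. This pointwise domination takes the
  place of Markov's inequality.\<close>

lemma bad_le_exp:
  shows "\<exists>X :: nat \<Rightarrow> nat \<Rightarrow> nat \<Rightarrow> history \<Rightarrow> real.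
    (\<forall>i n k h. 0 \<le> X i n k h) \<and>
    (\<forall>i\<in>{1..N}. \<forall>k\<ge>1. \<forall>n\<ge>1. E T (X i n k) \<le> 2 / (real N * real k ^ 3)) \<and>
    (\<forall>k\<ge>1. \<forall>h. bad k h \<longrightarrow> (\<exists>i\<in>{1..N}. \<exists>n\<in>{1..k}. 1 \<le> X i n k h))"
proof -
  define expo where "expo a b i k h = exp (a * obs_count i i k h - b * obs_count 0 i k h)"
    for a b :: real and i k h
  define P where "P i n k = (\<lambda>(a, b, a', b'). exponent_pair (v i) a b \<and> exponent_pair (v i) a' b' \<and>
    (\<forall>m\<ge>0. let w = m / real n; u = w + sqrt (w * (48 * logf k / real n)) + 48 * logf k / real n
       in (v i \<le> u \<and> u \<le> v i + 15 * sqrt (v i * logf k / real n) + 101 * logf k / real n) \<or>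
          1 \<le> exp (a * m - b * real n - 3 * logf k) + exp (a' * m - b' * real n - 3 * logf k)))"
    for i n k
  have P_ex: "\<exists>q. P i n k q" if "i \<in> {1..N}" "1 \<le> k" "1 \<le> n" for i n k
    using ucb_concentration[of "v i" "real n" "logf k"] v_bounds[OF that(1)] logf_pos[OF that(2)] that(3)
    unfolding P_def by simp
  \<comment> \<open>The choice depends on \<open>i\<close>, \<open>n\<close> and \<open>k\<close>
    but not on the history, so \<open>expectation_exp_le_1\<close> applies.\<close>
  define Q where "Q i n k = (SOME q. P i n k q)" for i n k
  define X where "X i n k h = (case Q i n k of (a, b, a', b') \<Rightarrow>
      exp (- 3 * logf k) * (expo a b i k h + expo a' b' i k h))" for i n k h
  have Q: "P i n k (Q i n k)" if "i \<in> {1..N}" "1 \<le> k" "1 \<le> n" for i n k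
    unfolding Q_def using P_ex[OF that] by (rule someI_ex)
  have "0 \<le> X i n k h" for i n k h by (simp add: X_def expo_def split: prod.split)
  moreover have "E T (X i n k) \<le> 2 / (real N * real k ^ 3)" if ink: "i \<in> {1..N}" "1 \<le> k" "1 \<le> n" for i n k
  proof -
    obtain a b a' b' where q: "Q i n k = (a, b, a', b')" by (metis prod_cases4)
    have ab: "exponent_pair (v i) a b" "exponent_pair (v i) a' b'"
      using Q[OF ink] unfolding P_def q by auto
    have "E T (X i n k) = exp (- 3 * logf k) * (E T (expo a b i k) + E T (expo a' b' i k))"
      unfolding X_def q by simp
    also have "\<dots> \<le> exp (- 3 * logf k) * (1 + 1)"
      using expectation_exp_le_1[OF ab(1), of T k] expectation_exp_le_1[OF ab(2), of T k] ink(1)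
      unfolding expo_def by (intro mult_left_mono add_mono) auto
    also have "\<dots> \<le> 1 / (real N * real k ^ 3) * (1 + 1)"
      using exp_minus_3_logf_le[OF ink(2)] by (intro mult_right_mono) auto
    finally show ?thesis by simp
  qed
  moreover have "\<exists>i\<in>{1..N}. \<exists>n\<in>{1..k}. 1 \<le> X i n k h" if k: "1 \<le> k" and bad: "bad k h" for k h
  proof -
    obtain i where i: "i \<in> {1..N}" and n: "obs_count 0 i k h \<noteq> 0"
      and nb: "\<not> (v i \<le> ucb k h i \<and> ucb k h i \<le> v i + bonus (logf k) i (obs_count 0 i k h))"
      using bad by (auto simp: bad_def)
    let ?n = "obs_count 0 i k h" and ?m = "obs_count i i k h"
    have n1: "1 \<le> ?n" using n by simp
    obtain a b a' b' where q: "Q i ?n k = (a, b, a', b')" by (metis prod_cases4)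
    have "1 \<le> exp (a * ?m - b * ?n - 3 * logf k) + exp (a' * ?m - b' * ?n - 3 * logf k)"
      using Q[OF i k n1] nb n unfolding P_def q
      by (auto simp: ucb_def ucb_of_counts_def bonus_def logf_def[symmetric] Let_def
          dest!: spec[of _ "real ?m"])
    also have "\<dots> = X i ?n k h"
      unfolding X_def q expo_def by (simp add: algebra_simps flip: exp_add)
    finally show ?thesis using i n1 obs_count_0_le[of i k h]
      by (intro bexI[of _ i] bexI[of _ ?n]) auto
  qed
  ultimately show ?thesis by blast
qed

text \<open>The union bound over \<open>N\<close> products and \<open>k\<close> counts turns
  \<open>2 / (N * k^3)\<close> into \<open>2 / k\<^sup>2\<close>, and the inverse squares sum to at
  most 2.\<close>

lemma expectation_bad_le: "E T (\<lambda>h. \<Sum>k=1..K. of_bool (bad k h)) \<le> 4"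
proof -
  obtain X :: "nat \<Rightarrow> nat \<Rightarrow> nat \<Rightarrow> history \<Rightarrow> real" where X0: "\<And>i n k h. 0 \<le> X i n k h"
    and XE: "\<And>i n k. i \<in> {1..N} \<Longrightarrow> 1 \<le> k \<Longrightarrow> 1 \<le> n \<Longrightarrow> E T (X i n k) \<le> 2 / (real N * real k ^ 3)"
    and X1: "\<And>k h. 1 \<le> k \<Longrightarrow> bad k h \<Longrightarrow> \<exists>i\<in>{1..N}. \<exists>n\<in>{1..k}. 1 \<le> X i n k h"
    using bad_le_exp[of T] by metis
  have le: "of_bool (bad k h) \<le> (\<Sum>i=1..N. \<Sum>n=1..k. X i n k h)" if k: "1 \<le> k" for k h
  proof (cases "bad k h")
    case True
    then obtain i n where mem: "i \<in> {1..N}" "n \<in> {1..k}" "1 \<le> X i n k h" using X1[OF k] by blast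
    note \<open>1 \<le> X i n k h\<close>
    also have "X i n k h \<le> (\<Sum>n=1..k. X i n k h)" using mem X0 by (intro member_le_sum) auto
    also have "\<dots> \<le> (\<Sum>i=1..N. \<Sum>n=1..k. X i n k h)"
      using mem X0 by (intro member_le_sum[of i _ "\<lambda>i. \<Sum>n=1..k. X i n k h"]) (auto intro: sum_nonneg)
    finally show ?thesis using True by simp
  qed (simp add: sum_nonneg X0)
  have "E T (\<lambda>h. \<Sum>k=1..K. of_bool (bad k h)) \<le> E T (\<lambda>h. \<Sum>k=1..K. \<Sum>i=1..N. \<Sum>n=1..k. X i n k h)"
    by (intro E_mono sum_mono le) simp
  also have "\<dots> = (\<Sum>k=1..K. \<Sum>i=1..N. \<Sum>n=1..k. E T (X i n k))" by simp
  also have "\<dots> \<le> (\<Sum>k=1..K. \<Sum>i=1..N. \<Sum>n=1..k. 2 / (real N * real k ^ 3))"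
    by (intro sum_mono XE) auto
  also have "\<dots> = (\<Sum>k=1..K. 2 * (1 / (real k)\<^sup>2))"
    using N_ge_1 by (intro sum.cong) (auto simp: power2_eq_square power3_eq_cube)
  also have "\<dots> \<le> 4" using sum_inverse_square_le[of K] by (simp only: sum_distrib_left[symmetric])
  finally show ?thesis .
qed

section \<open>Summation of the errors and the final bound\<close>

lemma sum_bonus_le:
  fixes n T :: nat
  assumes i: "i \<in> {1..N}" and L: "0 \<le> L" and n: "n \<le> T" and T: "1 \<le> T"
  shows "(\<Sum>j<n. bonus L i j) \<le> 1 + 30 * sqrt (v i * L * n) + 101 * L * (1 + ln T)"
proof -
  have vL: "0 \<le> v i * L" using v_bounds[OF i] L by simp
  have rhs: "0 \<le> 101 * L * (1 + ln T)" using L T by simp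
  show ?thesis
  proof (cases n)
    case 0
    then show ?thesis using rhs by simp
  next
    case (Suc n')
    \<comment> \<open>The first offer of a product is made with the default bound and contributes
      the summand 1.\<close>
    have "(\<Sum>j<n. bonus L i j) = 1 + (\<Sum>j<n'. bonus L i (Suc j))"
      unfolding Suc by (subst sum.lessThan_Suc_shift) (simp add: bonus_def)
    also have "(\<Sum>j<n'. bonus L i (Suc j)) = (\<Sum>j=1..n'. bonus L i j)"
      by (simp add: sum.atLeast_Suc_atMost_Suc_shift atLeast0LessThan[symmetric]
          sum.shift_bounds_Suc_ivl[symmetric] atLeastLessThanSuc_atLeastAtMost)
    also have "\<dots> = (\<Sum>j=1..n'. 15 * sqrt (v i * L) * (1 / sqrt (real j)) + 101 * L * (1 / real j))"
      by (intro sum.cong) (auto simp: bonus_def real_sqrt_divide)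
    also have "\<dots> = 15 * sqrt (v i * L) * (\<Sum>j=1..n'. 1 / sqrt (real j)) + 101 * L * (\<Sum>j=1..n'. 1 / real j)"
      by (simp only: sum.distrib sum_distrib_left)
    also have "\<dots> \<le> 15 * sqrt (v i * L) * (2 * sqrt n) + 101 * L * (1 + ln T)"
    proof (intro add_mono mult_left_mono)
      show "(\<Sum>j=1..n'. 1 / sqrt (real j)) \<le> 2 * sqrt n"
        using sum_inverse_sqrt_le[of n'] Suc by (simp add: order_trans)
      show "(\<Sum>j=1..n'. 1 / real j) \<le> 1 + ln T"
      proof (cases "n' = 0")
        case False
        then have "ln n' \<le> ln T" using n Suc by simp
        then show ?thesis using sum_inverse_le[of n'] False by linarith
      qed (use T in simp)
    qed (use vL L in auto)
    finally show ?thesis by (simp add: real_sqrt_mult)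
  qed
qed

text \<open>Each no-purchase time closes one epoch, played with the bounds available after
  \<open>epoch_of h t - 1\<close> epochs. It is charged crudely if one of these failed, and by
  optimism otherwise.\<close>

lemma sum_gap_le:
  assumes h: "follows_algorithm N F r h" and T: "length h = T" "1 \<le> T"
  shows "(\<Sum>t\<in>no_purchase_times h. gap (offer h t) * (1 + V (offer h t)))
    \<le> (real N + 1) * (\<Sum>k=1..T. of_bool (bad k h)) +
      (\<Sum>i=1..N. \<Sum>j<card {t \<in> no_purchase_times h. i \<in> offer h t}. bonus (logf T) i j)"
proof -
  let ?Z = "no_purchase_times h" and ?k = "\<lambda>t. epoch_of h t - 1"
  let ?Zi = "\<lambda>i. {t \<in> ?Z. i \<in> offer h t}"
  have finZ: "finite ?Z" by (rule finite_no_purchase_times)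
  \<comment> \<open>The count at the start of the epoch closed by \<open>t\<close> is the number of
    earlier closing times with \<open>i\<close> on offer, that is, the rank required by
    \<open>sum_over_rank\<close>.\<close>
  have count: "obs_count 0 i (?k t) h = card {s \<in> ?Zi i. s < t}" if "t \<in> ?Z" for i t
  proof -
    have "epoch_of h s \<le> ?k t \<longleftrightarrow> s < t" if "s \<in> ?Z" for s
      using epoch_of_less[of s h t] epoch_of_mono[of t s h] epoch_of_ge_1[of h t] that
      by (cases "s < t") (auto simp: no_purchase_times_def)
    then show ?thesis unfolding obs_count_def
      by (intro arg_cong[of _ _ card]) (auto simp: no_purchase_times_def)
  qed
  have kT: "?k t < T" if "t \<in> ?Z" for t
    using epoch_of_le[of t h] epoch_of_ge_1[of h t] that T by (auto simp: no_purchase_times_def)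
  have bonus_nonneg: "0 \<le> bonus (logf T) i n" if "i \<in> {1..N}" for i n
    using v_bounds[OF that] logf_pos[OF T(2)] by (simp add: bonus_def)
  have single: "gap (offer h t) * (1 + V (offer h t)) \<le>
      (real N + 1) * of_bool (bad (?k t) h) +
      (\<Sum>i\<in>offer h t. bonus (logf T) i (obs_count 0 i (?k t) h))" if t: "t \<in> ?Z" for t
  proof -
    have tI: "t \<in> {1..length h}" using t by (simp add: no_purchase_times_def)
    have S: "offer h t \<in> F" using offer_in_F[OF h tI] .
    show ?thesis
    proof (cases "bad (?k t) h")
      case True
      have "0 \<le> (\<Sum>i\<in>offer h t. bonus (logf T) i (obs_count 0 i (?k t) h))"
        using F_subset[OF S] by (intro sum_nonneg bonus_nonneg) auto
      then show ?thesis using gap_le_crude[OF S] True by simp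
    next
      case False
      have "is_arg_max (revenue r (ucb (?k t) h)) (\<lambda>S. S \<in> F) (offer h t)"
        using follows_algorithm_is_arg_max[OF h tI] by (simp add: ucb_def[abs_def])
      then have "gap (offer h t) * (1 + V (offer h t)) \<le> (\<Sum>i\<in>offer h t. ucb (?k t) h i - v i)"
        by (intro gap_le_optimism not_bad_bounds(1)[OF False])
      also have "\<dots> \<le> (\<Sum>i\<in>offer h t. bonus (logf T) i (obs_count 0 i (?k t) h))"
      proof (rule sum_mono)
        fix i assume "i \<in> offer h t"
        then have i: "i \<in> {1..N}" using F_subset[OF S] by blast
        have "bonus (logf (?k t)) i n \<le> bonus (logf T) i n" for n
          using logf_mono[of "?k t" T] kT[OF t] v_bounds[OF i]
          by (auto simp: bonus_def intro!: add_mono mult_left_mono divide_right_mono)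
        then show "ucb (?k t) h i - v i \<le> bonus (logf T) i (obs_count 0 i (?k t) h)"
          using not_bad_bounds(2)[OF False i] order_trans by blast
      qed
      finally show ?thesis using False by simp
    qed
  qed
  \<comment> \<open>Distinct closing times have distinct epochs, so each failing index is charged
    once; index 0 never fails.\<close>
  have bads: "(\<Sum>t\<in>?Z. of_bool (bad (?k t) h)) \<le> (\<Sum>k=1..T. of_bool (bad k h) :: real)"
  proof -
    have "inj_on ?k ?Z"
      using inj_on_epoch_of[of h] epoch_of_ge_1[of h]
      by (auto simp: inj_on_def) (metis le_add_diff_inverse)
    then have "(\<Sum>t\<in>?Z. of_bool (bad (?k t) h) :: real) = (\<Sum>k\<in>?k ` ?Z. of_bool (bad k h))"
      by (simp add: sum.reindex)
    also have "\<dots> \<le> (\<Sum>k\<in>{0..T}. of_bool (bad k h))"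
    proof (rule sum_mono2)
      show "?k ` ?Z \<subseteq> {0..T}" using less_imp_le[OF kT] by auto
    qed auto
    also have "\<dots> = (\<Sum>k=1..T. of_bool (bad k h))"
    proof -
      have "{0..T} = insert 0 {1..T}" by auto
      then show ?thesis using not_bad_0 by (simp only: sum.insert finite_atLeastAtMost) simp
    qed
    finally show ?thesis .
  qed
  have "(\<Sum>t\<in>?Z. \<Sum>i\<in>offer h t. bonus (logf T) i (obs_count 0 i (?k t) h)) =
      (\<Sum>t\<in>?Z. \<Sum>i | i \<in> {1..N} \<and> i \<in> offer h t. bonus (logf T) i (card {s \<in> ?Zi i. s < t}))"
  proof (intro sum.cong refl)
    fix t assume t: "t \<in> ?Z"
    then have "offer h t \<subseteq> {1..N}"
      using F_subset[OF offer_in_F[OF h]] by (simp add: no_purchase_times_def)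
    then show "offer h t = {i. i \<in> {1..N} \<and> i \<in> offer h t}" by blast
    fix i
    show "bonus (logf T) i (obs_count 0 i (?k t) h) = bonus (logf T) i (card {s \<in> ?Zi i. s < t})"
      using count[OF t] by simp
  qed
  \<comment> \<open>Summing over products first lets the ranks run through 0, 1, 2, ... for each
    product.\<close>
  also have "\<dots> = (\<Sum>i\<in>{1..N}. \<Sum>t\<in>?Zi i. bonus (logf T) i (card {s \<in> ?Zi i. s < t}))"
    using finZ by (intro sum.swap_restrict) auto
  also have "\<dots> = (\<Sum>i=1..N. \<Sum>j<card (?Zi i). bonus (logf T) i j)"
    using finZ by (intro sum.cong sum_over_rank) auto
  finally have widths: "(\<Sum>t\<in>?Z. \<Sum>i\<in>offer h t. bonus (logf T) i (obs_count 0 i (?k t) h)) =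
      (\<Sum>i=1..N. \<Sum>j<card (?Zi i). bonus (logf T) i j)" .
  have "(\<Sum>t\<in>?Z. gap (offer h t) * (1 + V (offer h t))) \<le>
      (\<Sum>t\<in>?Z. (real N + 1) * of_bool (bad (?k t) h) +
      (\<Sum>i\<in>offer h t. bonus (logf T) i (obs_count 0 i (?k t) h)))"
    by (intro sum_mono single)
  also have "\<dots> = (real N + 1) * (\<Sum>t\<in>?Z. of_bool (bad (?k t) h)) +
      (\<Sum>i=1..N. \<Sum>j<card (?Zi i). bonus (logf T) i j)"
    unfolding sum.distrib widths by (simp add: sum_distrib_left)
  also have "\<dots> \<le> (real N + 1) * (\<Sum>k=1..T. of_bool (bad k h)) +
      (\<Sum>i=1..N. \<Sum>j<card (?Zi i). bonus (logf T) i j)"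
    using bads by (intro add_right_mono mult_left_mono) auto
  finally show ?thesis .
qed

text \<open>The weighted mean inequality replaces the square roots of the counts by linear terms
  before expectations are taken. The linear part is then controlled by
  \<open>expectation_sum_V_le\<close>.\<close>

lemma regret_le:
  assumes T: "1 \<le> T" and a: "0 < a"
  shows "regret r v Sstar \<pi> T \<le> 4 * (real N + 1) + real N * (1 + 101 * logf T * (1 + ln T)) +
    15 * (a * T + real N * logf T / a)"
proof -
  let ?L = "logf T"
  have L: "0 \<le> ?L" using logf_pos[OF T] by simp
  let ?c = "real N * (1 + 101 * ?L * (1 + ln T)) + 15 * (real N * ?L / a)"
  have "(\<Sum>t\<in>no_purchase_times h. gap (offer h t) * (1 + V (offer h t)))
      \<le> (real N + 1) * (\<Sum>k=1..T. of_bool (bad k h)) +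
        (15 * a * (\<Sum>t\<in>no_purchase_times h. V (offer h t)) + ?c)"
    if h: "follows_algorithm N F r h" "length h = T" for h
  proof -
    let ?Z = "no_purchase_times h"
    let ?n = "\<lambda>i. card {t \<in> ?Z. i \<in> offer h t}"
    have finZ: "finite ?Z" by (rule finite_no_purchase_times)
    have n: "?n i \<le> T" for i
    proof -
      have "?n i \<le> card {1..T}" using h by (intro card_mono) (auto simp: no_purchase_times_def)
      then show ?thesis by simp
    qed
    have "(\<Sum>i=1..N. \<Sum>j<?n i. bonus ?L i j) \<le>
        (\<Sum>i=1..N. 1 + 15 * (a * (v i * ?n i) + ?L / a) + 101 * ?L * (1 + ln T))"
    proof (rule sum_mono)
      fix i assume i: "i \<in> {1..N}"
      have "v i * ?L * ?n i = v i * ?n i * ?L" by simp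
      then have AM: "2 * sqrt (v i * ?L * ?n i) \<le> a * (v i * ?n i) + ?L / a"
        using sqrt_le_AM[of "v i * ?n i" ?L a] v_bounds[OF i] L a by (simp only:) simp
      have "30 * sqrt (v i * ?L * ?n i) = 15 * (2 * sqrt (v i * ?L * ?n i))" by simp
      also have "\<dots> \<le> 15 * (a * (v i * ?n i) + ?L / a)"
        by (rule mult_left_mono[OF AM]) simp
      finally show "(\<Sum>j<?n i. bonus ?L i j) \<le>
          1 + 15 * (a * (v i * ?n i) + ?L / a) + 101 * ?L * (1 + ln T)"
        using sum_bonus_le[OF i L n[of i] T] by linarith
    qed
    also have "\<dots> = 15 * a * (\<Sum>i=1..N. v i * ?n i) + ?c"
      by (simp add: sum.distrib algebra_simps sum_distrib_left)
    \<comment> \<open>Double counting of the pairs of a closing time and a product on offer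
      then.\<close>
    also have "(\<Sum>i=1..N. v i * ?n i) = (\<Sum>i\<in>{1..N}. \<Sum>t | t \<in> ?Z \<and> i \<in> offer h t. v i)"
      by (simp add: mult.commute)
    also have "\<dots> = (\<Sum>t\<in>?Z. \<Sum>i | i \<in> {1..N} \<and> i \<in> offer h t. v i)"
      using finZ by (intro sum.swap_restrict) auto
    also have "\<dots> = (\<Sum>t\<in>?Z. V (offer h t))"
    proof (intro sum.cong refl)
      fix t assume "t \<in> ?Z"
      then have "offer h t \<subseteq> {1..N}"
        using F_subset[OF offer_in_F[OF h(1)]] by (simp add: no_purchase_times_def)
      then show "{i. i \<in> {1..N} \<and> i \<in> offer h t} = offer h t" by blast
    qed
    finally show ?thesis using sum_gap_le[OF h T] by linarith
  qed
  then have "E T (\<lambda>h. \<Sum>t\<in>no_purchase_times h. gap (offer h t) * (1 + V (offer h t))) \<le>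
      E T (\<lambda>h. (real N + 1) * (\<Sum>k=1..T. of_bool (bad k h)) +
        (15 * a * (\<Sum>t\<in>no_purchase_times h. V (offer h t)) + ?c))"
    by (rule E_mono)
  also have "\<dots> = (real N + 1) * E T (\<lambda>h. \<Sum>k=1..T. of_bool (bad k h)) +
      (15 * a * E T (\<lambda>h. \<Sum>t\<in>no_purchase_times h. V (offer h t)) + ?c)"
    by simp
  also have "\<dots> \<le> (real N + 1) * 4 + (15 * a * real T + ?c)"
    using expectation_bad_le[of T T] expectation_sum_V_le[of T] a
    by (intro add_mono mult_left_mono order_refl) auto
  finally show ?thesis using regret_le_no_purchase_sum[of T] by (simp add: algebra_simps)
qed

text \<open>For \<open>N * T = 1\<close> the logarithm in the final bound is 0, so there must be no
  regret at all. With all bounds at the default 1, the only product is compared at revenue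
  \<open>r 1 / 2\<close> with 0, which agrees with the true preference.\<close>

lemma regret_le_0: "N = 1 \<Longrightarrow> regret r v Sstar \<pi> 1 \<le> 0"
proof -
  assume N: "N = 1"
  have "E 1 (\<lambda>h. gap (offer h 1)) \<le> E 1 (\<lambda>h. 0)"
  proof (rule E_mono)
    fix h :: history assume h: "follows_algorithm N F r h" "length h = 1"
    have "is_arg_max (revenue r (\<lambda>i. 1)) (\<lambda>S. S \<in> F) (offer h 1)"
      using follows_algorithm_is_arg_max[OF h(1), of 1] h(2) obs_count_0_le[of _ 0 h]
      by (simp add: epoch_of_1[simplified] ucb_of_counts_def)
    then have S: "offer h 1 \<in> F" and le: "revenue r (\<lambda>i. 1) Sstar \<le> revenue r (\<lambda>i. 1) (offer h 1)"
      using Sstar_in_F by (auto simp: is_arg_max_def not_less)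
    have cases: "A = {} \<or> A = {1}" if "A \<in> F" for A using F_subset[OF that] N by auto
    show "gap (offer h 1) \<le> 0"
    proof (cases "Sstar = {}")
      case True
      then show ?thesis using revenue_bounds[OF S] by (simp add: revenue_def)
    next
      case False
      then have Sstar1: "Sstar = {1}" using cases[OF Sstar_in_F] by blast
      show ?thesis
      proof (cases "offer h 1 = {}")
        case True
        then have "r 1 \<le> 0" using le unfolding Sstar1 by (simp add: revenue_def)
        then have "r 1 = 0" using r_bounds[of 1] N by simp
        then show ?thesis unfolding True Sstar1 by (simp add: revenue_def)
      next
        case False
        then have "offer h 1 = {1}" using cases[OF S] by blast
        then show ?thesis unfolding Sstar1 by simp
      qed
    qed
  qed
  moreover have "regret r v Sstar \<pi> 1 = E 1 (\<lambda>h. gap (offer h 1))"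
    unfolding regret_eq by simp
  ultimately show ?thesis by simp
qed

text \<open>For \<open>x = N * T \<ge> 2\<close> one has \<open>x + 1 \<le> x\<^sup>2\<close>, which
  absorbs the added 1 at the cost of a factor 2.\<close>

lemma logf_le: "2 \<le> N * T \<Longrightarrow> logf T \<le> 2 * ln (real N * real T)"
proof -
  assume NT: "2 \<le> N * T"
  define x where "x = real N * real T"
  have x: "2 \<le> x" using NT unfolding x_def by (metis of_nat_le_iff of_nat_mult of_nat_numeral)
  have "sqrt (real N) \<le> real N" using N_ge_1 by (intro real_le_lsqrt) (auto simp: power2_eq_square)
  then have "sqrt (real N) * real T + 1 \<le> x + 1" unfolding x_def by (simp add: mult_right_mono)
  also have "\<dots> \<le> x\<^sup>2"
  proof -
    have "x + 1 \<le> x * 2" using x by simp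
    also have "\<dots> \<le> x * x" using x by (intro mult_left_mono) auto
    finally show ?thesis by (simp add: power2_eq_square)
  qed
  finally have "logf T \<le> ln (x\<^sup>2)" unfolding logf_def using x
    by (subst ln_le_cancel_iff) (auto intro: add_nonneg_pos)
  then show ?thesis using x by (simp add: ln_realpow x_def)
qed

lemma regret_bound:
  assumes T: "1 \<le> T"
  shows "regret r v Sstar \<pi> T \<le> 43 * sqrt (real N * real T * ln (real N * real T))
    + 642 * real N * (ln (real N * real T))\<^sup>2"
proof (cases "N * T = 1")
  case True
  then have "N = 1" "T = 1" by simp_all
  then show ?thesis using regret_le_0 by simp
next
  case False
  have NT: "2 \<le> N * T" using False N_ge_1 T by (cases "N * T") auto
  define y where "y = ln (real N * real T)"
  define L where "L = logf T"
  have "2 \<le> real N * real T" using NT by (metis of_nat_le_iff of_nat_mult of_nat_numeral)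
  then have "ln 2 \<le> y" unfolding y_def by (subst ln_le_cancel_iff) auto
  then have y: "1/2 \<le> y" using ln2_ge_two_thirds by simp
  have L: "0 < L" "L \<le> 2 * y" using logf_pos[OF T] logf_le[OF NT] by (auto simp: L_def y_def)
  have "ln T \<le> y" unfolding y_def using N_ge_1 T
    by (subst ln_le_cancel_iff) auto
  \<comment> \<open>The weight \<open>a = p / q = sqrt (N * L / T)\<close> balances
    \<open>a * T\<close> against \<open>N * L / a\<close>; both become \<open>p * q\<close>.\<close>
  define p where "p = sqrt (real N * L)"
  define q where "q = sqrt (real T)"
  have pq: "0 < p" "0 < q" "p\<^sup>2 = real N * L" "q\<^sup>2 = real T"
    using N_ge_1 T L by (auto simp: p_def q_def)
  have "regret r v Sstar \<pi> T \<le> 4 * (real N + 1) + real N * (1 + 101 * L * (1 + ln T)) +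
      15 * (p / q * T + real N * L / (p / q))"
    unfolding L_def by (rule regret_le[OF T]) (use pq in auto)
  also have "p / q * T = p * q" using pq by (simp add: power2_eq_square flip: pq(4))
  also have "real N * L / (p / q) = p * q" using pq by (simp add: power2_eq_square flip: pq(3))
  finally have reg: "regret r v Sstar \<pi> T \<le>
      4 * (real N + 1) + real N * (1 + 101 * L * (1 + ln T)) + 30 * (p * q)" by simp
  have "30 * (p * q) \<le> 43 * sqrt (real N * real T * y)"
  proof -
    have "p * q = sqrt (real N * real T * L)" by (simp add: p_def q_def real_sqrt_mult)
    also have "\<dots> \<le> sqrt (2 * (real N * real T * y))"
      using mult_left_mono[OF L(2), of "real N * real T"]
      by (intro real_sqrt_le_mono) (simp add: mult_ac)
    also have "\<dots> = sqrt 2 * sqrt (real N * real T * y)" by (rule real_sqrt_mult)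
    \<comment> \<open>The constant 43 comes from \<open>30 * sqrt 2 \<le> 43\<close>.\<close>
    also have "\<dots> \<le> 43 / 30 * sqrt (real N * real T * y)"
      using y by (intro mult_right_mono real_le_lsqrt) (auto simp: power2_eq_square)
    finally show ?thesis by simp
  qed
  moreover have "4 * (real N + 1) + real N * (1 + 101 * L * (1 + ln T)) \<le> 642 * real N * y\<^sup>2"
  proof -
    \<comment> \<open>Since \<open>1 \<le> 2 * y\<close> and \<open>ln T \<le> y\<close>, the second
      factor is at most \<open>3 * y\<close>.\<close>
    have "L * (1 + ln T) \<le> (2 * y) * (3 * y)"
      using L \<open>ln T \<le> y\<close> y T by (intro mult_mono) auto
    moreover have "1 \<le> 4 * y\<^sup>2" using power_mono[OF y, of 2] by (simp add: power2_eq_square)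
    \<comment> \<open>The constant is 9 * 4 + 101 * 6 = 642.\<close>
    ultimately have "9 + 101 * (L * (1 + ln T)) \<le> 642 * y\<^sup>2" by (simp add: power2_eq_square)
    then have "real N * (9 + 101 * (L * (1 + ln T))) \<le> real N * (642 * y\<^sup>2)"
      by (intro mult_left_mono) auto
    moreover have "4 * (real N + 1) \<le> 8 * real N" using N_ge_1 by simp
    ultimately show ?thesis by (simp add: algebra_simps)
  qed
  ultimately show ?thesis using reg unfolding y_def by linarith
qed

end

theorem theorem1:
  shows "\<exists>C1 C2 :: real.
    \<forall>(N :: nat) (m :: nat) (A :: real mat) (b :: real Matrix.vec)
     (r :: nat \<Rightarrow> real) (v :: nat \<Rightarrow> real) (Sstar :: nat set) (\<pi> :: policy) (T :: nat).
      N \<ge> 1 \<longrightarrow>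
      A \<in> carrier_mat m N \<longrightarrow> b \<in> carrier_vec m \<longrightarrow>
      totally_unimodular A \<longrightarrow> integral_vec b \<longrightarrow>
      (\<forall>S Q. S \<in> feasible N A b \<longrightarrow> Q \<subseteq> S \<longrightarrow> Q \<in> feasible N A b) \<longrightarrow>
      (\<forall>i\<in>{1..N}. 0 \<le> r i \<and> r i \<le> 1) \<longrightarrow>
      v 0 = 1 \<longrightarrow>
      (\<forall>i\<in>{1..N}. 0 < v i \<and> v i \<le> v 0) \<longrightarrow>
      T \<ge> 1 \<longrightarrow>
      is_arg_max (revenue r v) (\<lambda>S. S \<in> feasible N A b) Sstar \<longrightarrow>
      algorithm_policy N (feasible N A b) r \<pi> \<longrightarrow>
      regret r v Sstar \<pi> T
        \<le> C1 * sqrt (real N * real T * ln (real N * real T))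
          + C2 * real N * (ln (real N * real T))\<^sup>2"
proof (rule exI[of _ 43], rule exI[of _ 642], intro allI impI)
  fix N m :: nat and A :: "real mat" and b :: "real Matrix.vec" and r v :: "nat \<Rightarrow> real"
    and Sstar :: "nat set" and \<pi> :: policy and T :: nat
  assume N: "N \<ge> 1"
    and down: "\<forall>S Q. S \<in> feasible N A b \<longrightarrow> Q \<subseteq> S \<longrightarrow> Q \<in> feasible N A b"
    and r: "\<forall>i\<in>{1..N}. 0 \<le> r i \<and> r i \<le> 1"
    and v: "v 0 = 1" "\<forall>i\<in>{1..N}. 0 < v i \<and> v i \<le> v 0"
    and T: "T \<ge> 1"
    and opt: "is_arg_max (revenue r v) (\<lambda>S. S \<in> feasible N A b) Sstar"
    and alg: "algorithm_policy N (feasible N A b) r \<pi>"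
  interpret mnl_bandit N "feasible N A b" r v Sstar \<pi>
  proof
    show "S \<subseteq> {1..N}" if "S \<in> feasible N A b" for S using that by (simp add: feasible_def)
    show "Q \<in> feasible N A b" if "S \<in> feasible N A b" "Q \<subseteq> S" for S Q using down that by blast
    show "0 \<le> r i \<and> r i \<le> 1" if "i \<in> {1..N}" for i using r that by blast
    show "0 < v i \<and> v i \<le> 1" if "i \<in> {1..N}" for i using v that by auto
  qed (rule N v(1) opt alg)+
  show "regret r v Sstar \<pi> T \<le> 43 * sqrt (real N * real T * ln (real N * real T))
      + 642 * real N * (ln (real N * real T))\<^sup>2"
    by (rule regret_bound[OF T])
qed

end
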